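(* Let $R$ be a complete noetherian local domain of dimension $d\geq 2$ and of prime characteristic, with algebraically closed residue field. If $R$ is generalized Cohen--Macaulay and weakly normal, then $R$ is weakly Arf.
   Context: $\overline{R}$ is the integral closure of $R$ in its total quotient ring $Q(R)$. An integral extension of rings $i:A\hookrightarrow B$ is weakly subintegral if it induces a bijection $\operatorname{Spec}(B)\to\operatorname{Spec}(A)$ and for each $\mathfrak{p}\in\operatorname{Spec}(B)$ the induced map of residue fields $k(i^{-1}(\mathfrak{p}))\to k(\mathfrak{p})$ is a purely inseparable field extension. ${}^{\ast}R$ is the unique largest subextension of $R$ in $\overline{R}$ such that $R\subset{}^{\ast}R$ is weakly subintegral; $R$ is weakly normal if $R={}^{\ast}R$. A local ring $(R,\mathfrak{m})$ is generalized Cohen--Macaulay if $H^i_{\mathfrak{m}}(R)$ has finite length for all $i<\dim R$. A ring $R$ is weakly Arf if for every non-zerodivisor $x$ of $R$ and all $y,z\in R$ with $y/x,\,z/x\in\overline{R}$, one has $yz/x\in R$. *)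

theory Defs
  imports "HOL-Computational_Algebra.Primes" "HOL-Library.Extended_Nat" "HOL-Algebra.Algebra"
begin

section \<open>Chains, dimension, length, characteristic\<close>

text \<open>The supremum of all \<open>n\<close> such that \<open>F\<close> contains a chain \<open>C 0 \<subset> \<dots> \<subset> C n\<close>.\<close>

definition chain_length :: "'a set set \<Rightarrow> enat" where
  "chain_length F = (SUP n \<in> {n. \<exists>C :: nat \<Rightarrow> 'a set.
      (\<forall>i\<le>n. C i \<in> F) \<and> (\<forall>i<n. C i \<subset> C (Suc i))}. enat n)"

definition Spec :: "('a, 'r) ring_scheme \<Rightarrow> 'a set set" where
  "Spec R = {P. primeideal P R}"

definition krull_dim :: "('a, 'r) ring_scheme \<Rightarrow> enat" where
  "krull_dim R = chain_length (Spec R)"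

definition finite_length :: "('a, 'r) ring_scheme \<Rightarrow> ('a, 'b) module \<Rightarrow> bool" where
  "finite_length R M \<longleftrightarrow> module R M \<and> chain_length {N. submodule N R M} < \<infinity>"

definition ring_char :: "('a, 'r) ring_scheme \<Rightarrow> nat" where
  "ring_char R = (if \<exists>n::nat. n > 0 \<and> [n] \<cdot>\<^bsub>R\<^esub> \<one>\<^bsub>R\<^esub> = \<zero>\<^bsub>R\<^esub>
      then LEAST n::nat. n > 0 \<and> [n] \<cdot>\<^bsub>R\<^esub> \<one>\<^bsub>R\<^esub> = \<zero>\<^bsub>R\<^esub> else 0)"


section \<open>Complete local rings\<close>

definition local_ring :: "('a, 'r) ring_scheme \<Rightarrow> 'a set \<Rightarrow> bool" where
  "local_ring R \<mm> \<longleftrightarrow> cring R \<and> {I. maximalideal I R} = {\<mm>}"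

text \<open>Powers of ideals are powers in the monoid of ideals. The two conjuncts say that the
  canonical map from \<open>R\<close> to the inverse limit of the rings \<open>R / I\<^sup>n\<close> is injective and
  surjective.\<close>

definition adic_complete :: "('a, 'r) ring_scheme \<Rightarrow> 'a set \<Rightarrow> bool" where
  "adic_complete R I \<longleftrightarrow>
     (\<Inter>n::nat. I [^]\<^bsub>ideals_set R\<^esub> n) = {\<zero>\<^bsub>R\<^esub>} \<and>
     (\<forall>s :: nat \<Rightarrow> 'a. (\<forall>n. s n \<in> carrier R) \<and>
         (\<forall>n. s (Suc n) \<ominus>\<^bsub>R\<^esub> s n \<in> I [^]\<^bsub>ideals_set R\<^esub> n) \<longrightarrow>
       (\<exists>l \<in> carrier R. \<forall>n. l \<ominus>\<^bsub>R\<^esub> s n \<in> I [^]\<^bsub>ideals_set R\<^esub> n))"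


section \<open>Local cohomology\<close>

text \<open>The multiplicative fields that a module record inherits from ring records play no role
  and are left unspecified in quotients.\<close>

definition quotient_module ::
    "('a, 'r) ring_scheme \<Rightarrow> ('a, 'b) module \<Rightarrow> 'b set \<Rightarrow> ('a, 'b set) module" where
  "quotient_module R M N =
     \<lparr> carrier = a_rcosets\<^bsub>M\<^esub> N, monoid.mult = undefined, one = undefined,
       ring.zero = N, add = set_add M,
       smult = (\<lambda>r U. \<Union>x\<in>U. N +>\<^bsub>M\<^esub> (r \<odot>\<^bsub>M\<^esub> x)) \<rparr>"

definition regular_module :: "('a, 'r) ring_scheme \<Rightarrow> ('a, 'a) module" where
  "regular_module R =
     \<lparr> carrier = carrier R, monoid.mult = monoid.mult R, one = \<one>\<^bsub>R\<^esub>,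
       ring.zero = \<zero>\<^bsub>R\<^esub>, add = add R, smult = monoid.mult R \<rparr>"

definition module_hom ::
    "('a, 'r) ring_scheme \<Rightarrow> ('a, 'b) module \<Rightarrow> ('a, 'c) module \<Rightarrow> ('b \<Rightarrow> 'c) set" where
  "module_hom R M N = {f \<in> carrier M \<rightarrow> carrier N.
     (\<forall>x\<in>carrier M. \<forall>y\<in>carrier M. f (x \<oplus>\<^bsub>M\<^esub> y) = f x \<oplus>\<^bsub>N\<^esub> f y) \<and>
     (\<forall>r\<in>carrier R. \<forall>x\<in>carrier M. f (r \<odot>\<^bsub>M\<^esub> x) = r \<odot>\<^bsub>N\<^esub> f x)}"

text \<open>A definition cannot quantify over types, so the lifting property is required for modules
  whose elements have the type of the elements of \<open>R\<close>. These include \<open>R\<close> and its ideals, so by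
  Baer's criterion the lifting property follows for modules of every type.\<close>

definition injective_module :: "('a, 'r) ring_scheme \<Rightarrow> ('a, 'e) module \<Rightarrow> bool" where
  "injective_module R E \<longleftrightarrow> module R E \<and>
     (\<forall>(M :: ('a, 'a) module) (N :: ('a, 'a) module) f g.
        module R M \<and> module R N \<and> f \<in> module_hom R M N \<and> inj_on f (carrier M) \<and>
        g \<in> module_hom R M E \<longrightarrow>
        (\<exists>h \<in> module_hom R N E. \<forall>x\<in>carrier M. h (f x) = g x))"

definition injective_resolution ::
    "('a, 'r) ring_scheme \<Rightarrow> ('a, 'b) module \<Rightarrow> (nat \<Rightarrow> ('a, 'e) module) \<Rightarrow>
      (nat \<Rightarrow> 'e \<Rightarrow> 'e) \<Rightarrow> ('b \<Rightarrow> 'e) \<Rightarrow> bool" where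
  "injective_resolution R M E \<delta> \<epsilon> \<longleftrightarrow>
     module R M \<and> (\<forall>i. injective_module R (E i)) \<and>
     \<epsilon> \<in> module_hom R M (E 0) \<and> inj_on \<epsilon> (carrier M) \<and>
     (\<forall>i. \<delta> i \<in> module_hom R (E i) (E (Suc i))) \<and>
     \<epsilon> ` carrier M = {x \<in> carrier (E 0). \<delta> 0 x = \<zero>\<^bsub>E (Suc 0)\<^esub>} \<and>
     (\<forall>i. \<delta> i ` carrier (E i) =
        {x \<in> carrier (E (Suc i)). \<delta> (Suc i) x = \<zero>\<^bsub>E (Suc (Suc i))\<^esub>})"

definition torsion_part ::
    "('a, 'r) ring_scheme \<Rightarrow> 'a set \<Rightarrow> ('a, 'b) module \<Rightarrow> 'b set" where
  "torsion_part R I M = {x \<in> carrier M. \<exists>n::nat. \<forall>r \<in> I [^]\<^bsub>ideals_set R\<^esub> n. r \<odot>\<^bsub>M\<^esub> x = \<zero>\<^bsub>M\<^esub>}"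

text \<open>The \<open>i\<close>-th right derived functor of \<open>I\<close>-torsion, computed from the injective resolution
  with terms \<open>E\<close> and differentials \<open>\<delta>\<close>.\<close>

definition local_cohomology ::
    "('a, 'r) ring_scheme \<Rightarrow> 'a set \<Rightarrow> (nat \<Rightarrow> ('a, 'e) module) \<Rightarrow> (nat \<Rightarrow> 'e \<Rightarrow> 'e) \<Rightarrow> nat \<Rightarrow>
      ('a, 'e set) module" where
  "local_cohomology R I E \<delta> i =
     quotient_module R
       (E i \<lparr> carrier := {x \<in> torsion_part R I (E i). \<delta> i x = \<zero>\<^bsub>E (Suc i)\<^esub>} \<rparr>)
       (case i of 0 \<Rightarrow> {\<zero>\<^bsub>E 0\<^esub>} | Suc j \<Rightarrow> \<delta> j ` torsion_part R I (E j))"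

text \<open>The injective resolution is taken in the type \<open>'e\<close>. Local cohomology does
  not depend on the resolution up to isomorphism, so the choice of \<open>'e\<close> is immaterial as soon as
  it is large enough to carry an injective resolution of \<open>R\<close>; otherwise the predicate is false.
  A theorem that assumes it should therefore leave \<open>'e\<close> as a type variable.\<close>

definition generalized_cohen_macaulay ::
    "'e itself \<Rightarrow> ('a, 'r) ring_scheme \<Rightarrow> 'a set \<Rightarrow> bool" where
  "generalized_cohen_macaulay T R \<mm> \<longleftrightarrow> local_ring R \<mm> \<and>
     (\<exists>(E :: nat \<Rightarrow> ('a, 'e) module) \<delta> \<epsilon>. injective_resolution R (regular_module R) E \<delta> \<epsilon> \<and>
        (\<forall>i. enat i < krull_dim R \<longrightarrow> finite_length R (local_cohomology R \<mm> E \<delta> i)))"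


section \<open>Total quotient rings\<close>

definition nonzerodivisors :: "('a, 'r) ring_scheme \<Rightarrow> 'a set" where
  "nonzerodivisors R =
     {s \<in> carrier R. \<forall>a\<in>carrier R. a \<otimes>\<^bsub>R\<^esub> s = \<zero>\<^bsub>R\<^esub> \<longrightarrow> a = \<zero>\<^bsub>R\<^esub>}"

text \<open>The fraction \<open>a / s\<close>, as the class of all pairs representing it.\<close>

definition fraction :: "('a, 'r) ring_scheme \<Rightarrow> 'a \<Rightarrow> 'a \<Rightarrow> ('a \<times> 'a) set" where
  "fraction R a s =
     {(b, t). b \<in> carrier R \<and> t \<in> nonzerodivisors R \<and> a \<otimes>\<^bsub>R\<^esub> t = b \<otimes>\<^bsub>R\<^esub> s}"

text \<open>The unions range over all representatives of the operands; every choice of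
  representatives gives the same class.\<close>

definition total_quotient_ring :: "('a, 'r) ring_scheme \<Rightarrow> ('a \<times> 'a) set ring" where
  "total_quotient_ring R =
     \<lparr> carrier = {fraction R a s | a s. a \<in> carrier R \<and> s \<in> nonzerodivisors R},
       monoid.mult = (\<lambda>U V. \<Union>(a, s)\<in>U. \<Union>(b, t)\<in>V. fraction R (a \<otimes>\<^bsub>R\<^esub> b) (s \<otimes>\<^bsub>R\<^esub> t)),
       one = fraction R \<one>\<^bsub>R\<^esub> \<one>\<^bsub>R\<^esub>,
       ring.zero = fraction R \<zero>\<^bsub>R\<^esub> \<one>\<^bsub>R\<^esub>,
       add = (\<lambda>U V. \<Union>(a, s)\<in>U. \<Union>(b, t)\<in>V.
                fraction R (a \<otimes>\<^bsub>R\<^esub> t \<oplus>\<^bsub>R\<^esub> b \<otimes>\<^bsub>R\<^esub> s) (s \<otimes>\<^bsub>R\<^esub> t)) \<rparr>"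

definition to_fraction :: "('a, 'r) ring_scheme \<Rightarrow> 'a \<Rightarrow> ('a \<times> 'a) set" where
  "to_fraction R a = fraction R a \<one>\<^bsub>R\<^esub>"


section \<open>Integral closure and weakly Arf rings\<close>

text \<open>HOL-Algebra polynomials list their coefficients starting with the leading one, so
  \<open>\<one> # cs\<close> is a monic polynomial.\<close>

definition integral_over :: "('a, 'r) ring_scheme \<Rightarrow> 'a set \<Rightarrow> 'a \<Rightarrow> bool" where
  "integral_over B A u \<longleftrightarrow> (\<exists>cs. set cs \<subseteq> A \<and> ring.eval B (\<one>\<^bsub>B\<^esub> # cs) u = \<zero>\<^bsub>B\<^esub>)"

definition integral_closure :: "('a, 'r) ring_scheme \<Rightarrow> ('a \<times> 'a) set set" where
  "integral_closure R = {u \<in> carrier (total_quotient_ring R).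
     integral_over (total_quotient_ring R) (to_fraction R ` carrier R) u}"

definition weakly_arf :: "('a, 'r) ring_scheme \<Rightarrow> bool" where
  "weakly_arf R \<longleftrightarrow> (\<forall>x \<in> nonzerodivisors R. \<forall>y \<in> carrier R. \<forall>z \<in> carrier R.
     fraction R y x \<in> integral_closure R \<and> fraction R z x \<in> integral_closure R \<longrightarrow>
     fraction R (y \<otimes>\<^bsub>R\<^esub> z) x \<in> to_fraction R ` carrier R)"


section \<open>Weak subintegrality and weak normality\<close>

definition integral_extension ::
    "('a, 'r) ring_scheme \<Rightarrow> ('b, 's) ring_scheme \<Rightarrow> ('a \<Rightarrow> 'b) \<Rightarrow> bool" where
  "integral_extension A B i \<longleftrightarrow> cring A \<and> cring B \<and> i \<in> ring_hom A B \<and> inj_on i (carrier A) \<and>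
     (\<forall>b \<in> carrier B. integral_over B (i ` carrier A) b)"

definition contraction :: "('a, 'r) ring_scheme \<Rightarrow> ('a \<Rightarrow> 'b) \<Rightarrow> 'b set \<Rightarrow> 'a set" where
  "contraction A i P = {a \<in> carrier A. i a \<in> P}"

definition residue_field :: "('a, 'r) ring_scheme \<Rightarrow> 'a set \<Rightarrow> ('a set \<times> 'a set) set ring" where
  "residue_field R P = total_quotient_ring (R Quot P)"

text \<open>First the map induced by \<open>i\<close> from \<open>A / i\<^sup>-\<^sup>1(P)\<close> to \<open>B / P\<close>, then the one it induces on the
  fraction fields.\<close>

definition quotient_map ::
    "('b, 's) ring_scheme \<Rightarrow> ('a \<Rightarrow> 'b) \<Rightarrow> 'b set \<Rightarrow> 'a set \<Rightarrow> 'b set" where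
  "quotient_map B i P U = (\<Union>a\<in>U. P +>\<^bsub>B\<^esub> i a)"

definition residue_field_map ::
    "('b, 's) ring_scheme \<Rightarrow> ('a \<Rightarrow> 'b) \<Rightarrow> 'b set \<Rightarrow>
      ('a set \<times> 'a set) set \<Rightarrow> ('b set \<times> 'b set) set" where
  "residue_field_map B i P U =
     (\<Union>(a, s)\<in>U. fraction (B Quot P) (quotient_map B i P a) (quotient_map B i P s))"

text \<open>In characteristic zero the exponent is \<open>1\<close>, so that \<open>f\<close> is required to be surjective.\<close>

definition purely_inseparable ::
    "('a, 'r) ring_scheme \<Rightarrow> ('b, 's) ring_scheme \<Rightarrow> ('a \<Rightarrow> 'b) \<Rightarrow> bool" where
  "purely_inseparable K L f \<longleftrightarrow> field K \<and> field L \<and> f \<in> ring_hom K L \<and>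
     (\<forall>y \<in> carrier L. \<exists>n::nat. y [^]\<^bsub>L\<^esub> ((max 1 (ring_char K)) ^ n) \<in> f ` carrier K)"

definition weakly_subintegral ::
    "('a, 'r) ring_scheme \<Rightarrow> ('b, 's) ring_scheme \<Rightarrow> ('a \<Rightarrow> 'b) \<Rightarrow> bool" where
  "weakly_subintegral A B i \<longleftrightarrow> integral_extension A B i \<and>
     bij_betw (contraction A i) (Spec B) (Spec A) \<and>
     (\<forall>P \<in> Spec B. purely_inseparable
        (residue_field A (contraction A i P)) (residue_field B P) (residue_field_map B i P))"

definition weakly_subintegral_subextensions :: "('a, 'r) ring_scheme \<Rightarrow> ('a \<times> 'a) set set set" where
  "weakly_subintegral_subextensions R =
     {S. subring S (total_quotient_ring R) \<and>
         to_fraction R ` carrier R \<subseteq> S \<and> S \<subseteq> integral_closure R \<and>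
         weakly_subintegral R (total_quotient_ring R \<lparr> carrier := S \<rparr>) (to_fraction R)}"

text \<open>\<open>S\<close> is the largest weakly subintegral extension of \<open>R\<close> inside its integral closure.\<close>

definition is_weak_normalization :: "('a, 'r) ring_scheme \<Rightarrow> ('a \<times> 'a) set set \<Rightarrow> bool" where
  "is_weak_normalization R S \<longleftrightarrow> S \<in> weakly_subintegral_subextensions R \<and>
     (\<forall>T \<in> weakly_subintegral_subextensions R. T \<subseteq> S)"

definition weakly_normal :: "('a, 'r) ring_scheme \<Rightarrow> bool" where
  "weakly_normal R \<longleftrightarrow> is_weak_normalization R (to_fraction R ` carrier R)"

end

theory Submission
  imports Defs
begin

text \<open>The idea is that weak normality contains the following closure property: an element \<open>c\<close> of the
  fraction field \<open>K\<close> of \<open>R\<close> lies in \<open>R\<close> as soon as \<open>c\<^sup>2\<close> and \<open>c\<^sup>3\<close> do. Indeed \<open>R + R c\<close> is then a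
  ring, integral over \<open>R\<close>, and at each prime \<open>p\<close> of \<open>R\<close> one of two things happens. Either
  \<open>c\<^sup>2 \<in> p\<close>; then \<open>c\<close> lies in every prime above \<open>p\<close> and contributes nothing to the residue ring. Or
  \<open>c\<^sup>2 \<notin> p\<close>; then \<open>c = c\<^sup>3 / c\<^sup>2\<close> already lies in the localization of \<open>R\<close> at \<open>p\<close>. In both cases
  there is exactly one prime above \<open>p\<close>, with the same residue field. Hence \<open>R + R c\<close> is weakly
  subintegral over \<open>R\<close>, and weak normality forces \<open>c \<in> R\<close>. Repeated use of the property shows that
  \<open>c \<in> R\<close> whenever all sufficiently large powers of \<open>c\<close> are in \<open>R\<close>: if \<open>N \<ge> 1\<close> were
  the largest exponent with \<open>c\<^sup>N \<notin> R\<close>, the square and the cube of \<open>c\<^sup>N\<close> would lie in \<open>R\<close>.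

  Now let \<open>a = y / x\<close> and \<open>b = z / x\<close> be integral over \<open>R\<close>. The powers of an integral element have a
  common denominator, and as \<open>x a \<in> R\<close> that denominator can be taken to be a power of \<open>x\<close>: there are \<open>M\<close> and
  \<open>N\<close> with \<open>x\<^sup>M a\<^sup>n \<in> R\<close> and \<open>x\<^sup>N b\<^sup>n \<in> R\<close> for all \<open>n\<close>. The element \<open>c = y z / x = x a b\<close>
  therefore satisfies \<open>c\<^sup>n = x\<^sup>n a\<^sup>n b\<^sup>n \<in> R\<close> for all \<open>n \<ge> M + N\<close>, and so \<open>c \<in> R\<close>.

  The closure property is \<open>weakly_normal_square_cube\<close>, which rests on the proposition
  \<open>weakly_subintegral\<close> of the locale \<open>square_cube_extension\<close>; the common denominator is
  \<open>integral_bounded_denominator\<close>.\<close>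

section \<open>Fraction fields of domains\<close>

context domain
begin

lemma nonzerodivisors_eq: "nonzerodivisors R = carrier R - {\<zero>}"
proof -
  have "\<zero> \<notin> nonzerodivisors R"
    unfolding nonzerodivisors_def using one_not_zero by force
  moreover have "s \<in> nonzerodivisors R" if "s \<in> carrier R" "s \<noteq> \<zero>" for s
    unfolding nonzerodivisors_def using that by (auto simp: integral_iff)
  ultimately show ?thesis
    by (auto simp: nonzerodivisors_def)
qed

lemma mem_fraction_iff:
  "(b, t) \<in> fraction R a s \<longleftrightarrow> b \<in> carrier R \<and> t \<in> carrier R - {\<zero>} \<and> a \<otimes> t = b \<otimes> s"
  by (simp add: fraction_def nonzerodivisors_eq)

lemma cross_mult_trans:
  assumes "a \<in> carrier R" "b \<in> carrier R" "c \<in> carrier R"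
    "s \<in> carrier R" "t \<in> carrier R - {\<zero>}" "u \<in> carrier R"
    and "a \<otimes> t = b \<otimes> s" "b \<otimes> u = c \<otimes> t"
  shows "a \<otimes> u = c \<otimes> s"
proof -
  have "t \<otimes> (a \<otimes> u) = (a \<otimes> t) \<otimes> u" using assms(1-6) by (simp add: m_ac)
  also have "\<dots> = (b \<otimes> u) \<otimes> s" using assms(1-6) unfolding assms(7) by (simp add: m_ac)
  also have "\<dots> = t \<otimes> (c \<otimes> s)" using assms(1-6) unfolding assms(8) by (simp add: m_ac)
  finally show ?thesis using assms(1-6) m_lcancel[of t "a \<otimes> u" "c \<otimes> s"] by simp
qed

lemma fraction_eq_iff:
  assumes "a \<in> carrier R" "s \<in> carrier R - {\<zero>}" "b \<in> carrier R" "t \<in> carrier R - {\<zero>}"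
  shows "fraction R a s = fraction R b t \<longleftrightarrow> a \<otimes> t = b \<otimes> s"
proof
  assume "fraction R a s = fraction R b t"
  then have "(b, t) \<in> fraction R a s"
    using assms by (simp add: mem_fraction_iff)
  then show "a \<otimes> t = b \<otimes> s" by (simp add: mem_fraction_iff)
next
  assume eq: "a \<otimes> t = b \<otimes> s"
  have "(c, u) \<in> fraction R a s \<longleftrightarrow> (c, u) \<in> fraction R b t" for c u
  proof -
    have "b \<otimes> u = c \<otimes> t" if "c \<in> carrier R" "u \<in> carrier R - {\<zero>}" "a \<otimes> u = c \<otimes> s"
      using cross_mult_trans[of b a c t s u] that assms eq by simp
    moreover have "a \<otimes> u = c \<otimes> s" if "c \<in> carrier R" "u \<in> carrier R - {\<zero>}" "b \<otimes> u = c \<otimes> t"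
      using cross_mult_trans[of a b c s t u] that assms eq by simp
    ultimately show ?thesis by (auto simp: mem_fraction_iff)
  qed
  then show "fraction R a s = fraction R b t" by auto
qed

text \<open>An operation that is defined by a union over all representatives of a fraction is computed
  by any one of them, once it does not depend on the representative.\<close>

lemma UN_fraction:
  assumes "a \<in> carrier R" "s \<in> carrier R - {\<zero>}"
    and "\<And>b t. b \<in> carrier R \<Longrightarrow> t \<in> carrier R - {\<zero>} \<Longrightarrow> a \<otimes> t = b \<otimes> s \<Longrightarrow> F b t = F a s"
  shows "(\<Union>(b, t)\<in>fraction R a s. F b t) = F a s"
proof -
  have "(a, s) \<in> fraction R a s" using assms(1,2) by (simp add: mem_fraction_iff)
  moreover have "F b t = F a s" if "(b, t) \<in> fraction R a s" for b t
    using that assms(3) by (simp add: mem_fraction_iff)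
  ultimately show ?thesis by fast
qed

lemma fraction_mult:
  assumes "a \<in> carrier R" "s \<in> carrier R - {\<zero>}" "b \<in> carrier R" "t \<in> carrier R - {\<zero>}"
  shows "fraction R a s \<otimes>\<^bsub>total_quotient_ring R\<^esub> fraction R b t = fraction R (a \<otimes> b) (s \<otimes> t)"
proof -
  have inner: "(\<Union>(b, t)\<in>fraction R b t. fraction R (a' \<otimes> b) (s' \<otimes> t)) = fraction R (a' \<otimes> b) (s' \<otimes> t)"
    if a': "a' \<in> carrier R" and s': "s' \<in> carrier R - {\<zero>}" for a' s'
  proof (rule UN_fraction)
    fix b' t' assume *: "b' \<in> carrier R" "t' \<in> carrier R - {\<zero>}" "b \<otimes> t' = b' \<otimes> t"
    have "(a' \<otimes> b') \<otimes> (s' \<otimes> t) = (a' \<otimes> s') \<otimes> (b' \<otimes> t)" using *(1,2) a' s' assms by (simp add: m_ac)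
    also have "\<dots> = (a' \<otimes> b) \<otimes> (s' \<otimes> t')"
      unfolding *(3)[symmetric] using *(1,2) a' s' assms by (simp add: m_ac)
    finally show "fraction R (a' \<otimes> b') (s' \<otimes> t') = fraction R (a' \<otimes> b) (s' \<otimes> t)"
      using * a' s' assms by (subst fraction_eq_iff) (auto simp: integral_iff)
  qed (use assms in auto)
  have "(\<Union>(a', s')\<in>fraction R a s. \<Union>(b, t)\<in>fraction R b t. fraction R (a' \<otimes> b) (s' \<otimes> t))
      = (\<Union>(b, t)\<in>fraction R b t. fraction R (a \<otimes> b) (s \<otimes> t))"
  proof (rule UN_fraction)
    fix a' s' assume *: "a' \<in> carrier R" "s' \<in> carrier R - {\<zero>}" "a \<otimes> s' = a' \<otimes> s"
    have "(a' \<otimes> b) \<otimes> (s \<otimes> t) = (b \<otimes> t) \<otimes> (a' \<otimes> s)" using *(1,2) assms by (simp add: m_ac)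
    also have "\<dots> = (a \<otimes> b) \<otimes> (s' \<otimes> t)"
      unfolding *(3)[symmetric] using *(1,2) assms by (simp add: m_ac)
    finally have "fraction R (a' \<otimes> b) (s' \<otimes> t) = fraction R (a \<otimes> b) (s \<otimes> t)"
      using * assms by (subst fraction_eq_iff) (auto simp: integral_iff)
    then show "(\<Union>(b, t)\<in>fraction R b t. fraction R (a' \<otimes> b) (s' \<otimes> t))
      = (\<Union>(b, t)\<in>fraction R b t. fraction R (a \<otimes> b) (s \<otimes> t))"
      using * assms by (simp add: inner)
  qed (use assms in auto)
  then show ?thesis using assms inner by (simp add: total_quotient_ring_def)
qed

lemma fraction_add:
  assumes "a \<in> carrier R" "s \<in> carrier R - {\<zero>}" "b \<in> carrier R" "t \<in> carrier R - {\<zero>}"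
  shows "fraction R a s \<oplus>\<^bsub>total_quotient_ring R\<^esub> fraction R b t =
    fraction R (a \<otimes> t \<oplus> b \<otimes> s) (s \<otimes> t)"
proof -
  have inner: "(\<Union>(b, t)\<in>fraction R b t. fraction R (a' \<otimes> t \<oplus> b \<otimes> s') (s' \<otimes> t)) =
      fraction R (a' \<otimes> t \<oplus> b \<otimes> s') (s' \<otimes> t)"
    if a': "a' \<in> carrier R" and s': "s' \<in> carrier R - {\<zero>}" for a' s'
  proof (rule UN_fraction)
    fix b' t' assume *: "b' \<in> carrier R" "t' \<in> carrier R - {\<zero>}" "b \<otimes> t' = b' \<otimes> t"
    have "(a' \<otimes> t' \<oplus> b' \<otimes> s') \<otimes> (s' \<otimes> t) = a' \<otimes> t' \<otimes> s' \<otimes> t \<oplus> s' \<otimes> s' \<otimes> (b' \<otimes> t)"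
      using *(1,2) a' s' assms by (simp add: l_distr r_distr m_ac)
    also have "\<dots> = (a' \<otimes> t \<oplus> b \<otimes> s') \<otimes> (s' \<otimes> t')"
      unfolding *(3)[symmetric] using *(1,2) a' s' assms by (simp add: l_distr r_distr m_ac)
    finally show "fraction R (a' \<otimes> t' \<oplus> b' \<otimes> s') (s' \<otimes> t') = fraction R (a' \<otimes> t \<oplus> b \<otimes> s') (s' \<otimes> t)"
      using * a' s' assms by (subst fraction_eq_iff) (auto simp: integral_iff)
  qed (use assms in auto)
  have "(\<Union>(a', s')\<in>fraction R a s. \<Union>(b, t)\<in>fraction R b t. fraction R (a' \<otimes> t \<oplus> b \<otimes> s') (s' \<otimes> t))
      = (\<Union>(b, t)\<in>fraction R b t. fraction R (a \<otimes> t \<oplus> b \<otimes> s) (s \<otimes> t))"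
  proof (rule UN_fraction)
    fix a' s' assume *: "a' \<in> carrier R" "s' \<in> carrier R - {\<zero>}" "a \<otimes> s' = a' \<otimes> s"
    have "(a' \<otimes> t \<oplus> b \<otimes> s') \<otimes> (s \<otimes> t) = t \<otimes> t \<otimes> (a' \<otimes> s) \<oplus> b \<otimes> s' \<otimes> s \<otimes> t"
      using *(1,2) assms by (simp add: l_distr r_distr m_ac)
    also have "\<dots> = (a \<otimes> t \<oplus> b \<otimes> s) \<otimes> (s' \<otimes> t)"
      unfolding *(3)[symmetric] using *(1,2) assms by (simp add: l_distr r_distr m_ac)
    finally have "fraction R (a' \<otimes> t \<oplus> b \<otimes> s') (s' \<otimes> t) = fraction R (a \<otimes> t \<oplus> b \<otimes> s) (s \<otimes> t)"
      using * assms by (subst fraction_eq_iff) (auto simp: integral_iff)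
    then show "(\<Union>(b, t)\<in>fraction R b t. fraction R (a' \<otimes> t \<oplus> b \<otimes> s') (s' \<otimes> t))
      = (\<Union>(b, t)\<in>fraction R b t. fraction R (a \<otimes> t \<oplus> b \<otimes> s) (s \<otimes> t))"
      using * assms by (simp add: inner)
  qed (use assms in auto)
  then show ?thesis using assms inner by (simp add: total_quotient_ring_def)
qed

lemma fraction_closed:
  "a \<in> carrier R \<Longrightarrow> s \<in> carrier R - {\<zero>} \<Longrightarrow> fraction R a s \<in> carrier (total_quotient_ring R)"
  by (auto simp: total_quotient_ring_def nonzerodivisors_eq)

lemma fraction_cases:
  assumes "u \<in> carrier (total_quotient_ring R)"
  obtains a s where "a \<in> carrier R" "s \<in> carrier R - {\<zero>}" "u = fraction R a s"
  using assms by (auto simp: total_quotient_ring_def nonzerodivisors_eq)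

lemma total_quotient_ring_zero: "\<zero>\<^bsub>total_quotient_ring R\<^esub> = fraction R \<zero> \<one>"
  and total_quotient_ring_one: "\<one>\<^bsub>total_quotient_ring R\<^esub> = fraction R \<one> \<one>"
  by (simp_all add: total_quotient_ring_def)

lemma total_quotient_ring_is_field: "field (total_quotient_ring R)"
proof -
  let ?K = "total_quotient_ring R"
  note ops = fraction_mult fraction_add total_quotient_ring_zero total_quotient_ring_one
  note simps = ops fraction_closed fraction_eq_iff integral_iff
  have "abelian_group ?K"
  proof (rule abelian_groupI)
    fix x y z assume "x \<in> carrier ?K" "y \<in> carrier ?K" "z \<in> carrier ?K"
    then show "x \<oplus>\<^bsub>?K\<^esub> y \<oplus>\<^bsub>?K\<^esub> z = x \<oplus>\<^bsub>?K\<^esub> (y \<oplus>\<^bsub>?K\<^esub> z)"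
      by (elim fraction_cases) (simp add: simps, simp add: l_distr r_distr a_ac m_ac)
  next
    fix x assume "x \<in> carrier ?K"
    then obtain a s where as: "a \<in> carrier R" "s \<in> carrier R - {\<zero>}" "x = fraction R a s"
      by (rule fraction_cases)
    then have "fraction R (\<ominus> a) s \<oplus>\<^bsub>?K\<^esub> x = \<zero>\<^bsub>?K\<^esub>"
      by (simp add: simps l_minus l_neg)
    then show "\<exists>y\<in>carrier ?K. y \<oplus>\<^bsub>?K\<^esub> x = \<zero>\<^bsub>?K\<^esub>"
      using as by (auto intro!: bexI[of _ "fraction R (\<ominus> a) s"] simp: fraction_closed)
  next
    fix x y assume "x \<in> carrier ?K" "y \<in> carrier ?K"
    then show "x \<oplus>\<^bsub>?K\<^esub> y = y \<oplus>\<^bsub>?K\<^esub> x"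
      by (elim fraction_cases) (simp add: simps, simp add: a_ac m_ac)
    from \<open>x \<in> carrier ?K\<close> \<open>y \<in> carrier ?K\<close> show "x \<oplus>\<^bsub>?K\<^esub> y \<in> carrier ?K"
      by (elim fraction_cases) (simp add: simps)
  next
    fix x assume "x \<in> carrier ?K"
    then show "\<zero>\<^bsub>?K\<^esub> \<oplus>\<^bsub>?K\<^esub> x = x"
      by (elim fraction_cases) (simp add: simps)
  qed (simp add: simps)
  moreover have "comm_monoid ?K"
  proof (rule comm_monoidI)
    fix x y z assume "x \<in> carrier ?K" "y \<in> carrier ?K" "z \<in> carrier ?K"
    then show "x \<otimes>\<^bsub>?K\<^esub> y \<otimes>\<^bsub>?K\<^esub> z = x \<otimes>\<^bsub>?K\<^esub> (y \<otimes>\<^bsub>?K\<^esub> z)"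
      by (elim fraction_cases) (simp add: simps, simp add: m_ac)
  next
    fix x y assume "x \<in> carrier ?K" "y \<in> carrier ?K"
    then show "x \<otimes>\<^bsub>?K\<^esub> y = y \<otimes>\<^bsub>?K\<^esub> x"
      by (elim fraction_cases) (simp add: simps, simp add: m_ac)
    from \<open>x \<in> carrier ?K\<close> \<open>y \<in> carrier ?K\<close> show "x \<otimes>\<^bsub>?K\<^esub> y \<in> carrier ?K"
      by (elim fraction_cases) (simp add: simps)
  next
    fix x assume "x \<in> carrier ?K"
    then show "\<one>\<^bsub>?K\<^esub> \<otimes>\<^bsub>?K\<^esub> x = x"
      by (elim fraction_cases) (simp add: simps)
  qed (simp add: simps)
  moreover have "(x \<oplus>\<^bsub>?K\<^esub> y) \<otimes>\<^bsub>?K\<^esub> z = x \<otimes>\<^bsub>?K\<^esub> z \<oplus>\<^bsub>?K\<^esub> y \<otimes>\<^bsub>?K\<^esub> z"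
    if "x \<in> carrier ?K" "y \<in> carrier ?K" "z \<in> carrier ?K" for x y z
    using that by (elim fraction_cases) (simp add: simps, simp add: l_distr r_distr m_ac)
  ultimately have "cring ?K" by (rule cringI)
  then show ?thesis
  proof (rule cring.cring_fieldI2)
    show "\<zero>\<^bsub>?K\<^esub> \<noteq> \<one>\<^bsub>?K\<^esub>" by (simp add: simps)
    fix x assume x: "x \<in> carrier ?K" "x \<noteq> \<zero>\<^bsub>?K\<^esub>"
    from x(1) obtain a s where as: "a \<in> carrier R" "s \<in> carrier R - {\<zero>}" "x = fraction R a s"
      by (rule fraction_cases)
    with x(2) have "a \<noteq> \<zero>" by (auto simp: simps)
    then have "fraction R s a \<in> carrier ?K" "x \<otimes>\<^bsub>?K\<^esub> fraction R s a = \<one>\<^bsub>?K\<^esub>"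
      using as by (simp_all add: simps m_ac)
    then show "\<exists>y\<in>carrier ?K. x \<otimes>\<^bsub>?K\<^esub> y = \<one>\<^bsub>?K\<^esub>" ..
  qed
qed

lemma to_fraction_hom: "to_fraction R \<in> ring_hom R (total_quotient_ring R)"
  by (rule ring_hom_memI)
    (simp_all add: to_fraction_def fraction_closed fraction_mult fraction_add total_quotient_ring_one)

lemma to_fraction_inj: "inj_on (to_fraction R) (carrier R)"
  by (rule inj_onI) (simp add: to_fraction_def fraction_eq_iff)

lemma to_fraction_mult_fraction:
  assumes "a \<in> carrier R" "s \<in> carrier R - {\<zero>}"
  shows "to_fraction R s \<otimes>\<^bsub>total_quotient_ring R\<^esub> fraction R a s = to_fraction R a"
  using assms by (simp add: to_fraction_def fraction_mult fraction_eq_iff integral_iff m_ac)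

end

text \<open>The union in \<^const>\<open>residue_field_map\<close> is the one that describes the map on fraction fields
  induced by an injective homomorphism of domains.\<close>

lemma fraction_map_ring_hom:
  assumes "domain A" "domain B" and h: "h \<in> ring_hom A B" "inj_on h (carrier A)"
  defines "H \<equiv> \<lambda>U. \<Union>(a, s)\<in>U. fraction B (h a) (h s)"
  shows "H \<in> ring_hom (total_quotient_ring A) (total_quotient_ring B)"
    and "\<And>a s. a \<in> carrier A \<Longrightarrow> s \<in> carrier A - {\<zero>\<^bsub>A\<^esub>} \<Longrightarrow>
      H (fraction A a s) = fraction B (h a) (h s)"
proof -
  interpret A: domain A by fact
  interpret B: domain B by fact
  have h0: "h \<zero>\<^bsub>A\<^esub> = \<zero>\<^bsub>B\<^esub>" using ring_hom_zero[OF h(1) A.ring_axioms B.ring_axioms] .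
  have hnz: "h s \<in> carrier B - {\<zero>\<^bsub>B\<^esub>}" if "s \<in> carrier A - {\<zero>\<^bsub>A\<^esub>}" for s
    using that h h0 inj_onD[OF h(2), of s "\<zero>\<^bsub>A\<^esub>"] ring_hom_closed[OF h(1)] by auto
  note hc = ring_hom_closed[OF h(1)] ring_hom_mult[OF h(1)] ring_hom_add[OF h(1)] ring_hom_one[OF h(1)]
  show val: "H (fraction A a s) = fraction B (h a) (h s)"
    if "a \<in> carrier A" "s \<in> carrier A - {\<zero>\<^bsub>A\<^esub>}" for a s
    unfolding H_def
  proof (rule A.UN_fraction)
    fix b t assume *: "b \<in> carrier A" "t \<in> carrier A - {\<zero>\<^bsub>A\<^esub>}" "a \<otimes>\<^bsub>A\<^esub> t = b \<otimes>\<^bsub>A\<^esub> s"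
    have "h a \<otimes>\<^bsub>B\<^esub> h t = h b \<otimes>\<^bsub>B\<^esub> h s"
      using arg_cong[OF *(3), of h] *(1,2) that by (simp add: hc(2)[symmetric])
    then show "fraction B (h b) (h t) = fraction B (h a) (h s)"
      using * that hnz[of s] hnz[of t] by (simp add: B.fraction_eq_iff hc)
  qed (use that in auto)
  show "H \<in> ring_hom (total_quotient_ring A) (total_quotient_ring B)"
  proof (rule ring_hom_memI)
    fix x assume "x \<in> carrier (total_quotient_ring A)"
    then obtain a s where as: "a \<in> carrier A" "s \<in> carrier A - {\<zero>\<^bsub>A\<^esub>}" "x = fraction A a s"
      by (rule A.fraction_cases)
    then show "H x \<in> carrier (total_quotient_ring B)"
      using hnz[of s] by (simp add: val B.fraction_closed hc)
    fix y assume "y \<in> carrier (total_quotient_ring A)"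
    then obtain b t where bt: "b \<in> carrier A" "t \<in> carrier A - {\<zero>\<^bsub>A\<^esub>}" "y = fraction A b t"
      by (rule A.fraction_cases)
    have st: "s \<otimes>\<^bsub>A\<^esub> t \<in> carrier A - {\<zero>\<^bsub>A\<^esub>}" using as bt by (simp add: A.integral_iff)
    show "H (x \<otimes>\<^bsub>total_quotient_ring A\<^esub> y) = H x \<otimes>\<^bsub>total_quotient_ring B\<^esub> H y"
      using as bt st hnz[of s] hnz[of t] by (simp add: val hc A.fraction_mult B.fraction_mult)
    show "H (x \<oplus>\<^bsub>total_quotient_ring A\<^esub> y) = H x \<oplus>\<^bsub>total_quotient_ring B\<^esub> H y"
      using as bt st hnz[of s] hnz[of t] by (simp add: val hc A.fraction_add B.fraction_add)
  next
    show "H \<one>\<^bsub>total_quotient_ring A\<^esub> = \<one>\<^bsub>total_quotient_ring B\<^esub>"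
      by (simp add: A.total_quotient_ring_one B.total_quotient_ring_one val hc)
  qed
qed


section \<open>Extensions generated by an element whose square and cube descend\<close>

text \<open>The element \<open>u = r + s c\<close> is a root of \<open>(X - r)\<^sup>2 - s\<^sup>2 c\<^sup>2\<close>.\<close>

lemma (in cring) integral_over_quadratic:
  assumes "r \<in> carrier R" "s \<in> carrier R" "c \<in> carrier R"
    and "\<ominus> (r \<oplus> r) \<in> A" "r \<otimes> r \<ominus> s \<otimes> s \<otimes> (c \<otimes> c) \<in> A"
  shows "integral_over R A (r \<oplus> s \<otimes> c)"
proof -
  have "eval (\<one> # [\<ominus> (r \<oplus> r), r \<otimes> r \<ominus> s \<otimes> s \<otimes> (c \<otimes> c)]) (r \<oplus> s \<otimes> c) =
      (r \<oplus> s \<otimes> c) \<otimes> (r \<oplus> s \<otimes> c) \<oplus> (\<ominus> (r \<oplus> r) \<otimes> (r \<oplus> s \<otimes> c) \<oplus> (r \<otimes> r \<ominus> s \<otimes> s \<otimes> (c \<otimes> c)))"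
    using assms(1-3) by simp
  also have "\<dots> = \<zero>" using assms(1-3) by algebra
  finally show ?thesis
    using assms(4,5) unfolding integral_over_def
    by (intro exI[of _ "[\<ominus> (r \<oplus> r), r \<otimes> r \<ominus> s \<otimes> s \<otimes> (c \<otimes> c)]"]) simp
qed

text \<open>The extension \<open>B = A + A c\<close>, where \<open>c\<^sup>2\<close> and \<open>c\<^sup>3\<close> are the images of \<open>e\<close> and \<open>f\<close>. The
  representation of an element as \<open>r + s c\<close> is in general not unique.\<close>

locale square_cube_extension = ring_hom_cring A B i
  for A :: "('a, 'r) ring_scheme" (structure) and B :: "('b, 's) ring_scheme" (structure) and i +
  fixes c e f
  assumes inj: "inj_on i (carrier A)"
    and c: "c \<in> carrier B" and e: "e \<in> carrier A" and f: "f \<in> carrier A"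
    and square: "c \<otimes>\<^bsub>B\<^esub> c = i e" and cube: "c \<otimes>\<^bsub>B\<^esub> c \<otimes>\<^bsub>B\<^esub> c = i f"
    and generated: "\<And>u. u \<in> carrier B \<Longrightarrow>
      \<exists>r\<in>carrier A. \<exists>s\<in>carrier A. u = i r \<oplus>\<^bsub>B\<^esub> i s \<otimes>\<^bsub>B\<^esub> c"
begin

lemma is_integral_extension: "integral_extension A B i"
  unfolding integral_extension_def
proof (intro conjI ballI)
  fix u assume "u \<in> carrier B"
  then obtain r s where rs: "r \<in> carrier A" "s \<in> carrier A" and u: "u = i r \<oplus>\<^bsub>B\<^esub> i s \<otimes>\<^bsub>B\<^esub> c"
    using generated by blast
  have "\<ominus>\<^bsub>B\<^esub> (i r \<oplus>\<^bsub>B\<^esub> i r) = i (\<ominus> (r \<oplus> r))"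
    "i r \<otimes>\<^bsub>B\<^esub> i r \<ominus>\<^bsub>B\<^esub> i s \<otimes>\<^bsub>B\<^esub> i s \<otimes>\<^bsub>B\<^esub> (c \<otimes>\<^bsub>B\<^esub> c) = i (r \<otimes> r \<ominus> s \<otimes> s \<otimes> e)"
    using rs e by (simp_all add: square R.minus_eq S.minus_eq)
  moreover have "\<ominus> (r \<oplus> r) \<in> carrier A" "r \<otimes> r \<ominus> s \<otimes> s \<otimes> e \<in> carrier A"
    using rs e by simp_all
  ultimately show "integral_over B (i ` carrier A) u"
    unfolding u using rs c by (intro S.integral_over_quadratic) (simp_all only: imageI hom_closed)
qed (use R.is_cring S.is_cring inj homh in auto)

text \<open>Multiplication by \<open>c\<^sup>2\<close> carries \<open>B\<close> into \<open>A\<close>, since \<open>c\<^sup>2 (r + s c) = c\<^sup>2 r + c\<^sup>3 s\<close>. This is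
  the map \<open>B \<rightarrow> A\<close> that it defines.\<close>

definition mult_square :: "'b \<Rightarrow> 'a" where
  "mult_square u = inv_into (carrier A) i (i e \<otimes>\<^bsub>B\<^esub> u)"

lemma mult_square:
  assumes "u \<in> carrier B"
  shows "mult_square u \<in> carrier A" "i (mult_square u) = i e \<otimes>\<^bsub>B\<^esub> u"
proof -
  obtain r s where rs: "r \<in> carrier A" "s \<in> carrier A" and u: "u = i r \<oplus>\<^bsub>B\<^esub> i s \<otimes>\<^bsub>B\<^esub> c"
    using assms generated by blast
  have "i e \<otimes>\<^bsub>B\<^esub> u = i e \<otimes>\<^bsub>B\<^esub> i r \<oplus>\<^bsub>B\<^esub> i s \<otimes>\<^bsub>B\<^esub> (i e \<otimes>\<^bsub>B\<^esub> c)"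
    using rs e c by (simp add: u S.r_distr S.m_ac)
  also have "i e \<otimes>\<^bsub>B\<^esub> c = i f" by (simp add: square[symmetric] cube)
  also have "i e \<otimes>\<^bsub>B\<^esub> i r \<oplus>\<^bsub>B\<^esub> i s \<otimes>\<^bsub>B\<^esub> i f = i (e \<otimes> r \<oplus> s \<otimes> f)" using rs e f by simp
  finally have "i e \<otimes>\<^bsub>B\<^esub> u = i (e \<otimes> r \<oplus> s \<otimes> f)" .
  moreover have "e \<otimes> r \<oplus> s \<otimes> f \<in> carrier A" using rs e f by simp
  ultimately have "i e \<otimes>\<^bsub>B\<^esub> u \<in> i ` carrier A" by (simp only: imageI)
  then show "mult_square u \<in> carrier A" "i (mult_square u) = i e \<otimes>\<^bsub>B\<^esub> u"
    unfolding mult_square_def by (rule inv_into_into, rule f_inv_into_f)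
qed

lemma mult_square_eqI:
  "u \<in> carrier B \<Longrightarrow> a \<in> carrier A \<Longrightarrow> i a = i e \<otimes>\<^bsub>B\<^esub> u \<Longrightarrow> mult_square u = a"
  by (intro inj_onD[OF inj]) (simp_all add: mult_square)

lemma prime_contraction:
  assumes "P \<in> Spec B" shows "contraction A i P \<in> Spec A"
proof -
  interpret P: primeideal P B using assms by (simp add: Spec_def)
  have "ideal (contraction A i P) A"
    using ring.ideal_vimage[OF P.is_ideal] by (simp add: contraction_def)
  moreover have "\<one> \<notin> contraction A i P"
    using P.one_imp_carrier P.I_notcarr by (auto simp: contraction_def)
  then have "carrier A \<noteq> contraction A i P" by auto
  ultimately have "primeideal (contraction A i P) A"
    using P.I_prime by (intro primeidealI R.is_cring) (auto simp: contraction_def)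
  then show ?thesis by (simp add: Spec_def)
qed

text \<open>The prime of \<open>B\<close> above \<open>p\<close>: it contains \<open>c\<close> if \<open>c\<^sup>2 \<in> p\<close>, and otherwise \<open>c\<^sup>2\<close> is invertible
  at \<open>p\<close>, so that \<open>A\<close> and \<open>B\<close> agree there.\<close>

definition prime_above :: "'a set \<Rightarrow> 'b set" where
  "prime_above p =
     (if e \<in> p then {i r \<oplus>\<^bsub>B\<^esub> i s \<otimes>\<^bsub>B\<^esub> c | r s. r \<in> p \<and> s \<in> carrier A}
      else {u \<in> carrier B. mult_square u \<in> p})"

lemma square_mem_prime_iff:
  assumes "P \<in> Spec B" shows "e \<in> contraction A i P \<longleftrightarrow> c \<in> P"
proof -
  interpret P: primeideal P B using assms by (simp add: Spec_def)
  show ?thesis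
    using e c P.I_prime[of c c] P.I_l_closed[of c c] by (auto simp: contraction_def square[symmetric])
qed

text \<open>A prime of \<open>B\<close> can be recovered from its contraction. If it contains \<open>c\<close>, membership of
  \<open>r + s c\<close> only depends on \<open>r\<close>; if not, \<open>u\<close> belongs to it if and only if \<open>c\<^sup>2 u \<in> A\<close> does.\<close>

lemma prime_above_contraction:
  assumes "P \<in> Spec B" shows "prime_above (contraction A i P) = P"
proof -
  interpret P: primeideal P B using assms by (simp add: Spec_def)
  note eP = square_mem_prime_iff[OF assms]
  show ?thesis
  proof (cases "c \<in> P")
    case True
    have *: "i r \<oplus>\<^bsub>B\<^esub> i s \<otimes>\<^bsub>B\<^esub> c \<in> P \<longleftrightarrow> i r \<in> P" if "r \<in> carrier A" "s \<in> carrier A" for r s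
    proof
      have sc: "i s \<otimes>\<^bsub>B\<^esub> c \<in> P" using that True P.I_l_closed by simp
      then show "i r \<in> P \<Longrightarrow> i r \<oplus>\<^bsub>B\<^esub> i s \<otimes>\<^bsub>B\<^esub> c \<in> P" by (rule P.a_closed[rotated])
      assume "i r \<oplus>\<^bsub>B\<^esub> i s \<otimes>\<^bsub>B\<^esub> c \<in> P"
      from P.a_closed[OF this P.a_inv_closed[OF sc]]
      have *: "(i r \<oplus>\<^bsub>B\<^esub> i s \<otimes>\<^bsub>B\<^esub> c) \<oplus>\<^bsub>B\<^esub> \<ominus>\<^bsub>B\<^esub> (i s \<otimes>\<^bsub>B\<^esub> c) \<in> P" .
      have "i r \<in> carrier B" "i s \<otimes>\<^bsub>B\<^esub> c \<in> carrier B" using that c by simp_all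
      then have "(i r \<oplus>\<^bsub>B\<^esub> i s \<otimes>\<^bsub>B\<^esub> c) \<oplus>\<^bsub>B\<^esub> \<ominus>\<^bsub>B\<^esub> (i s \<otimes>\<^bsub>B\<^esub> c) = i r" by algebra
      with * show "i r \<in> P" by simp
    qed
    show ?thesis
    proof (intro equalityI subsetI)
      fix u assume "u \<in> P"
      moreover from this obtain r s where "r \<in> carrier A" "s \<in> carrier A" "u = i r \<oplus>\<^bsub>B\<^esub> i s \<otimes>\<^bsub>B\<^esub> c"
        using generated P.Icarr by blast
      ultimately show "u \<in> prime_above (contraction A i P)"
        using True * unfolding prime_above_def eP by (auto simp: contraction_def)
    qed (use True * eP in \<open>auto simp: prime_above_def contraction_def\<close>)
  next
    case False
    have "i e \<notin> P" using False e unfolding eP[symmetric] by (auto simp: contraction_def)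
    then have "mult_square u \<in> contraction A i P \<longleftrightarrow> u \<in> P" if "u \<in> carrier B" for u
      using that e P.I_prime[of "i e" u] P.I_l_closed[of u "i e"]
      by (auto simp: contraction_def mult_square)
    then show ?thesis using False P.Icarr by (auto simp: prime_above_def eP)
  qed
qed

text \<open>Membership does not depend on the representation: if \<open>r + s c = r' + s' c\<close> with \<open>r' \<in> p\<close>, then
  \<open>(r - r')\<^sup>2 = (s' - s)\<^sup>2 c\<^sup>2 \<in> p\<close>, so that \<open>r - r' \<in> p\<close>.\<close>

lemma mem_prime_above_iff:
  assumes "p \<in> Spec A" "e \<in> p" "r \<in> carrier A" "s \<in> carrier A"
  shows "i r \<oplus>\<^bsub>B\<^esub> i s \<otimes>\<^bsub>B\<^esub> c \<in> prime_above p \<longleftrightarrow> r \<in> p"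
proof
  interpret p: primeideal p A using assms(1) by (simp add: Spec_def)
  assume "i r \<oplus>\<^bsub>B\<^esub> i s \<otimes>\<^bsub>B\<^esub> c \<in> prime_above p"
  then obtain r' s' where r': "r' \<in> p" "s' \<in> carrier A"
    and eq: "i r \<oplus>\<^bsub>B\<^esub> i s \<otimes>\<^bsub>B\<^esub> c = i r' \<oplus>\<^bsub>B\<^esub> i s' \<otimes>\<^bsub>B\<^esub> c"
    using assms(2) by (auto simp: prime_above_def)
  have r'A: "r' \<in> carrier A" using r'(1) by (rule p.Icarr)
  let ?d = "s' \<ominus> s" and ?t = "r \<ominus> r'"
  have car: "?d \<in> carrier A" "?t \<in> carrier A" using assms r' r'A by auto
  have carB: "i r \<in> carrier B" "i s \<in> carrier B" "i r' \<in> carrier B" "i s' \<in> carrier B"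
    using assms(3,4) r' r'A by simp_all
  have "i ?t = i r \<oplus>\<^bsub>B\<^esub> \<ominus>\<^bsub>B\<^esub> i r'"
    using assms(3,4) r' r'A by (simp add: R.minus_eq)
  also have "\<dots> = (i r \<oplus>\<^bsub>B\<^esub> i s \<otimes>\<^bsub>B\<^esub> c) \<ominus>\<^bsub>B\<^esub> (i r' \<oplus>\<^bsub>B\<^esub> i s \<otimes>\<^bsub>B\<^esub> c)"
    using carB c by algebra
  also have "\<dots> = (i s' \<oplus>\<^bsub>B\<^esub> \<ominus>\<^bsub>B\<^esub> i s) \<otimes>\<^bsub>B\<^esub> c"
    unfolding eq using carB c by algebra
  also have "\<dots> = i ?d \<otimes>\<^bsub>B\<^esub> c"
    using assms(3,4) r' r'A by (simp add: R.minus_eq)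
  finally have "i ?t = i ?d \<otimes>\<^bsub>B\<^esub> c" .
  then have "i (?t \<otimes> ?t) = i ?d \<otimes>\<^bsub>B\<^esub> i ?d \<otimes>\<^bsub>B\<^esub> (c \<otimes>\<^bsub>B\<^esub> c)"
    using car c by (simp add: S.m_ac)
  then have "i (?t \<otimes> ?t) = i (?d \<otimes> ?d \<otimes> e)" using car e by (simp add: square)
  then have "?t \<otimes> ?t = ?d \<otimes> ?d \<otimes> e" by (rule inj_onD[OF inj]) (use car e in simp_all)
  then have "?t \<otimes> ?t \<in> p" using p.I_l_closed[OF assms(2)] car by simp
  then have "?t \<in> p" using p.I_prime[of ?t ?t] car by blast
  then have "?t \<oplus> r' \<in> p" using r' by (intro p.a_closed)
  moreover have "?t \<oplus> r' = r" using assms(3) r'A by algebra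
  ultimately show "r \<in> p" by simp
qed (use assms in \<open>auto simp: prime_above_def\<close>)

text \<open>If \<open>c\<^sup>2 \<in> p\<close>, the constant coefficient of \<open>(r + s c) (r' + s' c)\<close> is \<open>r r'\<close> modulo \<open>p\<close>. If
  \<open>c\<^sup>2 \<notin> p\<close>, the claims follow from \<open>(c\<^sup>2 u) (c\<^sup>2 v) = c\<^sup>2 (c\<^sup>2 u v)\<close>, in which the outer
  factor \<open>c\<^sup>2\<close> can be cancelled modulo \<open>p\<close>.\<close>

lemma prime_above_Spec:
  assumes "p \<in> Spec A"
  shows "prime_above p \<in> Spec B" and "contraction A i (prime_above p) = p"
proof -
  interpret p: primeideal p A using assms by (simp add: Spec_def)
  have "primeideal (prime_above p) B \<and> contraction A i (prime_above p) = p"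
  proof (cases "e \<in> p")
    case True
    note mem = mem_prime_above_iff[OF assms True]
    have mult: "(i r \<oplus>\<^bsub>B\<^esub> i s \<otimes>\<^bsub>B\<^esub> c) \<otimes>\<^bsub>B\<^esub> (i r' \<oplus>\<^bsub>B\<^esub> i s' \<otimes>\<^bsub>B\<^esub> c) =
        i (r \<otimes> r' \<oplus> s \<otimes> s' \<otimes> e) \<oplus>\<^bsub>B\<^esub> i (r \<otimes> s' \<oplus> s \<otimes> r') \<otimes>\<^bsub>B\<^esub> c"
      if "r \<in> carrier A" "s \<in> carrier A" "r' \<in> carrier A" "s' \<in> carrier A" for r s r' s'
    proof -
      have "i r \<in> carrier B" "i s \<in> carrier B" "i r' \<in> carrier B" "i s' \<in> carrier B"
        using that by simp_all
      then have "(i r \<oplus>\<^bsub>B\<^esub> i s \<otimes>\<^bsub>B\<^esub> c) \<otimes>\<^bsub>B\<^esub> (i r' \<oplus>\<^bsub>B\<^esub> i s' \<otimes>\<^bsub>B\<^esub> c) =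
          (i r \<otimes>\<^bsub>B\<^esub> i r' \<oplus>\<^bsub>B\<^esub> i s \<otimes>\<^bsub>B\<^esub> i s' \<otimes>\<^bsub>B\<^esub> (c \<otimes>\<^bsub>B\<^esub> c)) \<oplus>\<^bsub>B\<^esub>
          (i r \<otimes>\<^bsub>B\<^esub> i s' \<oplus>\<^bsub>B\<^esub> i s \<otimes>\<^bsub>B\<^esub> i r') \<otimes>\<^bsub>B\<^esub> c"
        using c by algebra
      then show ?thesis using that e by (simp add: square)
    qed
    have sub: "prime_above p \<subseteq> carrier B"
      using True c by (auto simp: prime_above_def p.Icarr)
    have repr: "\<exists>r\<in>p. \<exists>s\<in>carrier A. u = i r \<oplus>\<^bsub>B\<^esub> i s \<otimes>\<^bsub>B\<^esub> c" if "u \<in> prime_above p" for u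
      using that True by (auto simp: prime_above_def)
    have img: "i r = i r \<oplus>\<^bsub>B\<^esub> i \<zero> \<otimes>\<^bsub>B\<^esub> c" if "r \<in> carrier A" for r
      using that c by simp
    have contr: "i r \<in> prime_above p \<longleftrightarrow> r \<in> p" if "r \<in> carrier A" for r
      using mem[of r \<zero>] that img[OF that] by simp
    have times: "u \<otimes>\<^bsub>B\<^esub> v \<in> prime_above p" if uP: "u \<in> prime_above p" and vB: "v \<in> carrier B" for u v
    proof -
      obtain r s where rs: "r \<in> p" "s \<in> carrier A" "u = i r \<oplus>\<^bsub>B\<^esub> i s \<otimes>\<^bsub>B\<^esub> c" using repr[OF uP] by blast
      obtain r' s' where rs': "r' \<in> carrier A" "s' \<in> carrier A" "v = i r' \<oplus>\<^bsub>B\<^esub> i s' \<otimes>\<^bsub>B\<^esub> c"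
        using generated[OF vB] by blast
      have "r \<otimes> r' \<oplus> s \<otimes> s' \<otimes> e \<in> p"
        using rs rs' True by (intro p.a_closed p.I_r_closed p.I_l_closed) auto
      then show ?thesis using rs rs' p.Icarr[OF rs(1)] e
        by (simp add: mult mem del: hom_add hom_mult)
    qed
    have "primeideal (prime_above p) B"
    proof (rule primeidealI2)
      show "additive_subgroup (prime_above p) B"
      proof (rule additive_subgroup.intro, rule S.add.subgroupI)
        show "prime_above p \<noteq> {}" using contr[of \<zero>] by auto
        fix u assume u: "u \<in> prime_above p"
        then show "\<ominus>\<^bsub>B\<^esub> u \<in> prime_above p"
          using times[of u "\<ominus>\<^bsub>B\<^esub> \<one>\<^bsub>B\<^esub>"] sub by (auto simp: S.r_minus)
        fix v assume v: "v \<in> prime_above p"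
        obtain r s where rs: "r \<in> p" "s \<in> carrier A" "u = i r \<oplus>\<^bsub>B\<^esub> i s \<otimes>\<^bsub>B\<^esub> c" using repr[OF u] by blast
        obtain r' s' where rs': "r' \<in> p" "s' \<in> carrier A" "v = i r' \<oplus>\<^bsub>B\<^esub> i s' \<otimes>\<^bsub>B\<^esub> c"
          using repr[OF v] by blast
        have "u \<oplus>\<^bsub>B\<^esub> v = i (r \<oplus> r') \<oplus>\<^bsub>B\<^esub> i (s \<oplus> s') \<otimes>\<^bsub>B\<^esub> c"
          using rs rs' c p.Icarr[OF rs(1)] p.Icarr[OF rs'(1)] by (simp add: S.l_distr S.a_ac)
        moreover have "r \<oplus> r' \<in> p" using rs rs' by (intro p.a_closed)
        ultimately show "u \<oplus>\<^bsub>B\<^esub> v \<in> prime_above p"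
          using rs rs' mem[of "r \<oplus> r'" "s \<oplus> s'"] p.Icarr by simp
      qed (rule sub)
      show "u \<otimes>\<^bsub>B\<^esub> v \<in> prime_above p" if "u \<in> prime_above p" "v \<in> carrier B" for u v
        using times that .
      then show "v \<otimes>\<^bsub>B\<^esub> u \<in> prime_above p" if "u \<in> prime_above p" "v \<in> carrier B" for u v
        using that sub S.m_comm[of v u] by auto
      show "carrier B \<noteq> prime_above p"
        using contr[of \<one>] p.one_imp_carrier p.I_notcarr by auto
      fix u v assume uv: "u \<in> carrier B" "v \<in> carrier B" "u \<otimes>\<^bsub>B\<^esub> v \<in> prime_above p"
      obtain r s where rs: "r \<in> carrier A" "s \<in> carrier A" "u = i r \<oplus>\<^bsub>B\<^esub> i s \<otimes>\<^bsub>B\<^esub> c"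
        using generated[OF uv(1)] by blast
      obtain r' s' where rs': "r' \<in> carrier A" "s' \<in> carrier A" "v = i r' \<oplus>\<^bsub>B\<^esub> i s' \<otimes>\<^bsub>B\<^esub> c"
        using generated[OF uv(2)] by blast
      have "r \<otimes> r' \<oplus> s \<otimes> s' \<otimes> e \<in> p" using uv(3) rs rs' e
        by (simp add: mult mem del: hom_add hom_mult)
      moreover have "\<ominus> (s \<otimes> s' \<otimes> e) \<in> p"
        using rs rs' True by (intro p.a_inv_closed p.I_l_closed) auto
      ultimately have "(r \<otimes> r' \<oplus> s \<otimes> s' \<otimes> e) \<oplus> \<ominus> (s \<otimes> s' \<otimes> e) \<in> p" by (rule p.a_closed)
      then have "r \<otimes> r' \<in> p" using rs rs' e by (simp add: R.a_assoc R.r_neg)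
      then show "u \<in> prime_above p \<or> v \<in> prime_above p"
        using p.I_prime[of r r'] rs rs' by (auto simp: mem)
    qed (rule S.is_cring)
    then show ?thesis using contr p.Icarr by (auto simp: contraction_def)
  next
    case False
    have mem: "u \<in> prime_above p \<longleftrightarrow> u \<in> carrier B \<and> mult_square u \<in> p" for u
      using False by (simp add: prime_above_def)
    have add: "mult_square (u \<oplus>\<^bsub>B\<^esub> v) = mult_square u \<oplus> mult_square v"
      if "u \<in> carrier B" "v \<in> carrier B" for u v
      using that e by (intro mult_square_eqI) (simp_all add: mult_square S.r_distr)
    have mult: "mult_square u \<otimes> mult_square v = e \<otimes> mult_square (u \<otimes>\<^bsub>B\<^esub> v)"
      if "u \<in> carrier B" "v \<in> carrier B" for u v
      using that e by (intro inj_onD[OF inj]) (simp_all add: mult_square S.m_ac)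
    have img: "mult_square (i r) = e \<otimes> r" if "r \<in> carrier A" for r
      using that e by (intro mult_square_eqI) simp_all
    have e_cancel: "e \<otimes> r \<in> p \<longleftrightarrow> r \<in> p" if "r \<in> carrier A" for r
      using that e False p.I_prime[of e r] p.I_l_closed[of r e] by auto
    have contr: "i r \<in> prime_above p \<longleftrightarrow> r \<in> p" if "r \<in> carrier A" for r
      using that by (simp add: mem img e_cancel)
    have prod: "u \<otimes>\<^bsub>B\<^esub> v \<in> prime_above p \<longleftrightarrow> mult_square u \<otimes> mult_square v \<in> p"
      if "u \<in> carrier B" "v \<in> carrier B" for u v
      using that by (simp add: mem mult e_cancel mult_square)
    have "primeideal (prime_above p) B"
    proof (rule primeidealI2)
      show "additive_subgroup (prime_above p) B"
      proof (rule additive_subgroup.intro, rule S.add.subgroupI)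
        show "prime_above p \<noteq> {}" using contr[of \<zero>] by auto
        fix u assume u: "u \<in> prime_above p"
        have "mult_square (\<ominus>\<^bsub>B\<^esub> u) = \<ominus> mult_square u"
          using u e by (intro mult_square_eqI) (simp_all add: mem mult_square S.r_minus)
        then show "\<ominus>\<^bsub>B\<^esub> u \<in> prime_above p" using u by (simp add: mem)
        fix v assume "v \<in> prime_above p"
        then show "u \<oplus>\<^bsub>B\<^esub> v \<in> prime_above p" using u by (simp add: mem add)
      qed (auto simp: mem)
      show times: "u \<otimes>\<^bsub>B\<^esub> v \<in> prime_above p" if "u \<in> prime_above p" "v \<in> carrier B" for u v
        using that prod[of u v] mult_square by (auto simp: mem intro: p.I_r_closed)
      show "v \<otimes>\<^bsub>B\<^esub> u \<in> prime_above p" if "u \<in> prime_above p" "v \<in> carrier B" for u v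
        using that prod[of v u] mult_square by (auto simp: mem intro: p.I_l_closed)
      show "carrier B \<noteq> prime_above p"
        using contr[of \<one>] p.one_imp_carrier p.I_notcarr by auto
      fix u v assume uv: "u \<in> carrier B" "v \<in> carrier B" "u \<otimes>\<^bsub>B\<^esub> v \<in> prime_above p"
      then show "u \<in> prime_above p \<or> v \<in> prime_above p"
        using prod p.I_prime[of "mult_square u" "mult_square v"] mult_square by (auto simp: mem)
    qed (rule S.is_cring)
    then show ?thesis using contr p.Icarr by (auto simp: contraction_def)
  qed
  then show "prime_above p \<in> Spec B" and "contraction A i (prime_above p) = p"
    by (simp_all add: Spec_def)
qed

lemma Spec_bij: "bij_betw (contraction A i) (Spec B) (Spec A)"
  by (rule bij_betw_byWitness[of _ prime_above])
    (auto simp: prime_above_contraction prime_above_Spec prime_contraction)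

text \<open>Multiplying numerator and denominator by \<open>w\<close> brings every fraction of elements of \<open>B / P\<close>
  into the residue field of \<open>A\<close>. If \<open>c \<in> P\<close>, then \<open>A\<close> maps onto \<open>B / P\<close> and \<open>w = 1\<close> will do;
  otherwise \<open>w = c\<^sup>2\<close> does.\<close>

lemma common_denominator:
  assumes "P \<in> Spec B"
  obtains w where "w \<in> carrier B" "w \<notin> P"
    "\<And>u. u \<in> carrier B \<Longrightarrow> \<exists>r\<in>carrier A. P +>\<^bsub>B\<^esub> (w \<otimes>\<^bsub>B\<^esub> u) = P +>\<^bsub>B\<^esub> i r"
proof -
  interpret P: primeideal P B using assms by (simp add: Spec_def)
  show ?thesis
  proof (cases "c \<in> P")
    case True
    show ?thesis
    proof (rule that[of "\<one>\<^bsub>B\<^esub>"])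
      show "\<one>\<^bsub>B\<^esub> \<notin> P" using P.one_imp_carrier P.I_notcarr by auto
      fix u assume "u \<in> carrier B"
      then obtain r s where rs: "r \<in> carrier A" "s \<in> carrier A" "u = i r \<oplus>\<^bsub>B\<^esub> i s \<otimes>\<^bsub>B\<^esub> c"
        using generated by blast
      have "P +>\<^bsub>B\<^esub> (i s \<otimes>\<^bsub>B\<^esub> c) = P"
        using rs True P.I_l_closed by (intro P.a_rcos_const) simp
      then have "P +>\<^bsub>B\<^esub> u = (P +>\<^bsub>B\<^esub> i r) <+>\<^bsub>B\<^esub> (P +>\<^bsub>B\<^esub> \<zero>\<^bsub>B\<^esub>)"
        using rs c P.a_rcos_sum[of "i r" "i s \<otimes>\<^bsub>B\<^esub> c"] P.a_rcos_const[OF P.zero_closed] by simp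
      also have "\<dots> = P +>\<^bsub>B\<^esub> i r" using rs P.a_rcos_sum[of "i r" "\<zero>\<^bsub>B\<^esub>"] by simp
      finally show "\<exists>r\<in>carrier A. P +>\<^bsub>B\<^esub> (\<one>\<^bsub>B\<^esub> \<otimes>\<^bsub>B\<^esub> u) = P +>\<^bsub>B\<^esub> i r"
        using rs \<open>u \<in> carrier B\<close> by auto
    qed simp
  next
    case False
    show ?thesis
    proof (rule that[of "i e"])
      show "i e \<notin> P" using False e square_mem_prime_iff[OF assms] by (auto simp: contraction_def)
      fix u assume "u \<in> carrier B"
      then show "\<exists>r\<in>carrier A. P +>\<^bsub>B\<^esub> (i e \<otimes>\<^bsub>B\<^esub> u) = P +>\<^bsub>B\<^esub> i r"
        using mult_square[of u] by (auto intro!: bexI[of _ "mult_square u"])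
    qed (use e in simp)
  qed
qed

end


lemma (in ideal) rcos_eq_iff:
  assumes "a \<in> carrier R" "b \<in> carrier R"
  shows "I +> a = I +> b \<longleftrightarrow> a \<ominus> b \<in> I"
proof -
  have "I +> a = I +> b \<longleftrightarrow> a \<in> I +> b"
    using a_repr_independence'[OF _ assms(2)] a_repr_independenceD[OF assms(1)] by metis
  then show ?thesis
    using a_rcos_module_minus[OF ring_axioms assms(2,1)] by simp
qed

lemma quotient_map_hom:
  assumes hom: "ring_hom_cring A B i" and P: "ideal P B"
  defines "p \<equiv> contraction A i P"
  shows "quotient_map B i P \<in> ring_hom (A Quot p) (B Quot P)"
    and "inj_on (quotient_map B i P) (carrier (A Quot p))"
    and "\<And>a. a \<in> carrier A \<Longrightarrow> quotient_map B i P (p +>\<^bsub>A\<^esub> a) = P +>\<^bsub>B\<^esub> i a"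
proof -
  interpret ring_hom_cring A B i by fact
  interpret P: ideal P B by fact
  interpret p: ideal p A
    using ring.ideal_vimage[OF P] by (simp add: p_def contraction_def)
  have mem_iff: "a \<ominus>\<^bsub>A\<^esub> b \<in> p \<longleftrightarrow> i a \<ominus>\<^bsub>B\<^esub> i b \<in> P"
    if "a \<in> carrier A" "b \<in> carrier A" for a b
    using that unfolding p_def contraction_def R.minus_eq S.minus_eq by simp
  show val: "quotient_map B i P (p +>\<^bsub>A\<^esub> a) = P +>\<^bsub>B\<^esub> i a" if a: "a \<in> carrier A" for a
  proof -
    have const: "P +>\<^bsub>B\<^esub> i b = P +>\<^bsub>B\<^esub> i a" if b: "b \<in> p +>\<^bsub>A\<^esub> a" for b
    proof -
      have "b \<in> carrier A" using p.a_elemrcos_carrier[OF a b] .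
      moreover have "b \<ominus>\<^bsub>A\<^esub> a \<in> p"
        using p.a_rcos_module_minus[OF R.ring_axioms a \<open>b \<in> carrier A\<close>] b by blast
      ultimately have "i b \<ominus>\<^bsub>B\<^esub> i a \<in> P" using mem_iff a by blast
      then show ?thesis
        using P.rcos_eq_iff[of "i b" "i a"] a \<open>b \<in> carrier A\<close> by blast
    qed
    have "p +>\<^bsub>A\<^esub> a \<noteq> {}" using p.a_rcos_self[OF a] by (metis empty_iff)
    then have "(\<Union>b\<in>p +>\<^bsub>A\<^esub> a. P +>\<^bsub>B\<^esub> i b) = P +>\<^bsub>B\<^esub> i a"
    proof (rule SUP_eq_const)
      fix b assume "b \<in> p +>\<^bsub>A\<^esub> a"
      then show "P +>\<^bsub>B\<^esub> i b = P +>\<^bsub>B\<^esub> i a" by (rule const)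
    qed
    then show ?thesis by (simp only: quotient_map_def)
  qed
  have carrA: "\<exists>a\<in>carrier A. U = p +>\<^bsub>A\<^esub> a" if "U \<in> carrier (A Quot p)" for U
    using that by (auto simp: FactRing_simps)
  show "inj_on (quotient_map B i P) (carrier (A Quot p))"
  proof (rule inj_onI)
    fix U V assume UV: "U \<in> carrier (A Quot p)" "V \<in> carrier (A Quot p)"
      and eq: "quotient_map B i P U = quotient_map B i P V"
    obtain a b where "a \<in> carrier A" "U = p +>\<^bsub>A\<^esub> a" "b \<in> carrier A" "V = p +>\<^bsub>A\<^esub> b"
      using carrA[OF UV(1)] carrA[OF UV(2)] by blast
    then show "U = V"
      using eq mem_iff P.rcos_eq_iff[of "i a" "i b"] p.rcos_eq_iff[of a b] val by auto
  qed
  show "quotient_map B i P \<in> ring_hom (A Quot p) (B Quot P)"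
  proof (rule ring_hom_memI)
    fix U assume "U \<in> carrier (A Quot p)"
    then obtain a where a: "a \<in> carrier A" "U = p +>\<^bsub>A\<^esub> a" using carrA by blast
    then show "quotient_map B i P U \<in> carrier (B Quot P)"
      by (auto simp: val FactRing_simps)
    fix V assume "V \<in> carrier (A Quot p)"
    then obtain b where b: "b \<in> carrier A" "V = p +>\<^bsub>A\<^esub> b" using carrA by blast
    show "quotient_map B i P (U \<otimes>\<^bsub>A Quot p\<^esub> V) =
        quotient_map B i P U \<otimes>\<^bsub>B Quot P\<^esub> quotient_map B i P V"
      using a b val[of "a \<otimes>\<^bsub>A\<^esub> b"] by (simp add: val FactRing_def p.rcoset_mult_add P.rcoset_mult_add)
    show "quotient_map B i P (U \<oplus>\<^bsub>A Quot p\<^esub> V) =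
        quotient_map B i P U \<oplus>\<^bsub>B Quot P\<^esub> quotient_map B i P V"
      using a b val[of "a \<oplus>\<^bsub>A\<^esub> b"] by (simp add: val FactRing_def p.a_rcos_sum P.a_rcos_sum)
  next
    show "quotient_map B i P \<one>\<^bsub>A Quot p\<^esub> = \<one>\<^bsub>B Quot P\<^esub>"
      using val[of "\<one>\<^bsub>A\<^esub>"] by (simp add: FactRing_def)
  qed
qed

context square_cube_extension
begin

text \<open>The map of residue fields is even surjective, so the exponent in the definition of pure
  inseparability can be taken to be zero.\<close>

lemma residue_fields_agree:
  assumes "P \<in> Spec B"
  defines "p \<equiv> contraction A i P"
  shows "purely_inseparable (residue_field A p) (residue_field B P) (residue_field_map B i P)"
proof -
  interpret P: primeideal P B using assms by (simp add: Spec_def)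
  interpret p: primeideal p A
    using prime_contraction[OF assms(1)] by (simp add: Spec_def p_def)
  interpret Ap: domain "A Quot p" by (rule p.quotient_is_domain)
  interpret BP: domain "B Quot P" by (rule P.quotient_is_domain)
  interpret L: field "total_quotient_ring (B Quot P)" by (rule BP.total_quotient_ring_is_field)
  note q = quotient_map_hom[OF ring_hom_cring_axioms P.is_ideal, folded p_def]
  note H = fraction_map_ring_hom[OF Ap.domain_axioms BP.domain_axioms q(1,2),
      folded residue_field_map_def]
  have zero: "\<zero>\<^bsub>A Quot p\<^esub> = p" "\<zero>\<^bsub>B Quot P\<^esub> = P" by (simp_all add: FactRing_def)
  have P_eq: "P +>\<^bsub>B\<^esub> u = P \<longleftrightarrow> u \<in> P" if "u \<in> carrier B" for u
    using that P.a_rcos_const P.rcos_const_imp_mem by auto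
  obtain w where w: "w \<in> carrier B" "w \<notin> P"
    and w_repr: "\<And>u. u \<in> carrier B \<Longrightarrow> \<exists>r\<in>carrier A. P +>\<^bsub>B\<^esub> (w \<otimes>\<^bsub>B\<^esub> u) = P +>\<^bsub>B\<^esub> i r"
    using common_denominator[OF assms(1)] by blast
  have "y \<in> residue_field_map B i P ` carrier (total_quotient_ring (A Quot p))"
    if "y \<in> carrier (total_quotient_ring (B Quot P))" for y
  proof -
    obtain U V where UV: "U \<in> carrier (B Quot P)" "V \<in> carrier (B Quot P) - {\<zero>\<^bsub>B Quot P\<^esub>}"
      and y: "y = fraction (B Quot P) U V"
      using BP.fraction_cases[OF \<open>y \<in> _\<close>] by blast
    obtain u v where u: "u \<in> carrier B" "U = P +>\<^bsub>B\<^esub> u" and v: "v \<in> carrier B" "V = P +>\<^bsub>B\<^esub> v"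
      using UV by (auto simp: FactRing_simps)
    obtain r s where r: "r \<in> carrier A" "P +>\<^bsub>B\<^esub> (w \<otimes>\<^bsub>B\<^esub> u) = P +>\<^bsub>B\<^esub> i r"
      and s: "s \<in> carrier A" "P +>\<^bsub>B\<^esub> (w \<otimes>\<^bsub>B\<^esub> v) = P +>\<^bsub>B\<^esub> i s"
      using w_repr[OF u(1)] w_repr[OF v(1)] by metis
    have carr: "P +>\<^bsub>B\<^esub> x \<in> carrier (B Quot P)" if "x \<in> carrier B" for x
      using that by (auto simp: FactRing_simps)
    have mult: "(P +>\<^bsub>B\<^esub> x) \<otimes>\<^bsub>B Quot P\<^esub> (P +>\<^bsub>B\<^esub> x') = P +>\<^bsub>B\<^esub> (x \<otimes>\<^bsub>B\<^esub> x')"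
      if "x \<in> carrier B" "x' \<in> carrier B" for x x'
      using that by (simp add: FactRing_def P.rcoset_mult_add)
    have "v \<notin> P" using UV(2) v by (simp add: zero P_eq)
    then have "w \<otimes>\<^bsub>B\<^esub> v \<notin> P" using w v P.I_prime[of w v] by blast
    then have is_nz: "P +>\<^bsub>B\<^esub> i s \<noteq> P"
      unfolding s(2)[symmetric] using P_eq[of "w \<otimes>\<^bsub>B\<^esub> v"] w v by simp
    have s_nz: "p +>\<^bsub>A\<^esub> s \<noteq> p"
    proof
      assume "p +>\<^bsub>A\<^esub> s = p"
      then have "i s \<in> P" using p.rcos_const_imp_mem[OF s(1)] unfolding p_def contraction_def by blast
      then show False using is_nz P_eq[of "i s"] s(1) by simp
    qed
    have rs_carr: "p +>\<^bsub>A\<^esub> r \<in> carrier (A Quot p)"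
      "p +>\<^bsub>A\<^esub> s \<in> carrier (A Quot p) - {\<zero>\<^bsub>A Quot p\<^esub>}"
      using r(1) s(1) s_nz unfolding zero by (auto simp: FactRing_simps)
    have "U \<otimes>\<^bsub>B Quot P\<^esub> (P +>\<^bsub>B\<^esub> i s) = (P +>\<^bsub>B\<^esub> i r) \<otimes>\<^bsub>B Quot P\<^esub> V"
      using u v w by (simp add: mult r(2)[symmetric] s(2)[symmetric] S.m_ac)
    then have "y = fraction (B Quot P) (P +>\<^bsub>B\<^esub> i r) (P +>\<^bsub>B\<^esub> i s)"
      using UV r s is_nz unfolding y by (subst BP.fraction_eq_iff) (simp_all add: carr zero)
    also have "\<dots> = residue_field_map B i P (fraction (A Quot p) (p +>\<^bsub>A\<^esub> r) (p +>\<^bsub>A\<^esub> s))"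
      using H(2)[OF rs_carr] q(3) r s by simp
    finally show ?thesis
      using Ap.fraction_closed[OF rs_carr] by (rule image_eqI)
  qed
  then show ?thesis
    unfolding purely_inseparable_def residue_field_def
    using Ap.total_quotient_ring_is_field L.field_axioms H(1)
    by (auto intro!: exI[of _ 0])
qed

proposition weakly_subintegral: "weakly_subintegral A B i"
  unfolding weakly_subintegral_def using is_integral_extension Spec_bij residue_fields_agree by blast

end

section \<open>Weakly normal domains\<close>

lemma (in domain) weakly_normal_square_cube:
  assumes "weakly_normal R" and c: "c \<in> carrier (total_quotient_ring R)"
    and "c [^]\<^bsub>total_quotient_ring R\<^esub> (2::nat) \<in> to_fraction R ` carrier R"
    and "c [^]\<^bsub>total_quotient_ring R\<^esub> (3::nat) \<in> to_fraction R ` carrier R"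
  shows "c \<in> to_fraction R ` carrier R"
proof -
  let ?K = "total_quotient_ring R" and ?i = "to_fraction R"
  interpret K: field ?K by (rule total_quotient_ring_is_field)
  interpret i: ring_hom_cring R ?K ?i
    by (intro ring_hom_cring.intro ring_hom_cring_axioms.intro is_cring K.is_cring to_fraction_hom)
  obtain e f where e: "e \<in> carrier R" "c \<otimes>\<^bsub>?K\<^esub> c = ?i e"
    and f: "f \<in> carrier R" "c \<otimes>\<^bsub>?K\<^esub> c \<otimes>\<^bsub>?K\<^esub> c = ?i f"
    using assms(3,4) c by (auto simp: numeral_2_eq_2 numeral_3_eq_3)
  define S where "S = {?i r \<oplus>\<^bsub>?K\<^esub> ?i s \<otimes>\<^bsub>?K\<^esub> c | r s. r \<in> carrier R \<and> s \<in> carrier R}"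
  have S_I: "?i r \<oplus>\<^bsub>?K\<^esub> ?i s \<otimes>\<^bsub>?K\<^esub> c \<in> S" if "r \<in> carrier R" "s \<in> carrier R" for r s
    using that by (auto simp: S_def)
  have S_E: "\<exists>r\<in>carrier R. \<exists>s\<in>carrier R. u = ?i r \<oplus>\<^bsub>?K\<^esub> ?i s \<otimes>\<^bsub>?K\<^esub> c" if "u \<in> S" for u
    using that by (auto simp: S_def)
  have R_S: "?i r \<in> S" if "r \<in> carrier R" for r
    using S_I[OF that zero_closed] that c by simp
  have sub: "subring S ?K"
  proof (rule K.subringI)
    show "S \<subseteq> carrier ?K" using c by (auto simp: S_def)
    show "\<one>\<^bsub>?K\<^esub> \<in> S" using R_S[of \<one>] by simp
    fix u v assume "u \<in> S" "v \<in> S"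
    then obtain r s r' s' where carr: "r \<in> carrier R" "s \<in> carrier R" "r' \<in> carrier R" "s' \<in> carrier R"
      and u: "u = ?i r \<oplus>\<^bsub>?K\<^esub> ?i s \<otimes>\<^bsub>?K\<^esub> c" and v: "v = ?i r' \<oplus>\<^bsub>?K\<^esub> ?i s' \<otimes>\<^bsub>?K\<^esub> c"
      using S_E by meson
    have carrK: "?i r \<in> carrier ?K" "?i s \<in> carrier ?K" "?i r' \<in> carrier ?K" "?i s' \<in> carrier ?K"
      using carr by simp_all
    have "\<ominus>\<^bsub>?K\<^esub> u = ?i (\<ominus> r) \<oplus>\<^bsub>?K\<^esub> ?i (\<ominus> s) \<otimes>\<^bsub>?K\<^esub> c"
      using carr c by (simp add: u K.minus_add K.l_minus)
    then show "\<ominus>\<^bsub>?K\<^esub> u \<in> S" using S_I[of "\<ominus> r" "\<ominus> s"] carr by simp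
    have "u \<oplus>\<^bsub>?K\<^esub> v = ?i (r \<oplus> r') \<oplus>\<^bsub>?K\<^esub> ?i (s \<oplus> s') \<otimes>\<^bsub>?K\<^esub> c"
      using carr c by (simp add: u v K.l_distr K.a_ac)
    then show "u \<oplus>\<^bsub>?K\<^esub> v \<in> S" using S_I[of "r \<oplus> r'" "s \<oplus> s'"] carr by simp
    have "u \<otimes>\<^bsub>?K\<^esub> v =
        (?i r \<otimes>\<^bsub>?K\<^esub> ?i r' \<oplus>\<^bsub>?K\<^esub> ?i s \<otimes>\<^bsub>?K\<^esub> ?i s' \<otimes>\<^bsub>?K\<^esub> (c \<otimes>\<^bsub>?K\<^esub> c)) \<oplus>\<^bsub>?K\<^esub>
        (?i r \<otimes>\<^bsub>?K\<^esub> ?i s' \<oplus>\<^bsub>?K\<^esub> ?i s \<otimes>\<^bsub>?K\<^esub> ?i r') \<otimes>\<^bsub>?K\<^esub> c"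
      unfolding u v using carrK c by algebra
    also have "\<dots> = ?i (r \<otimes> r' \<oplus> s \<otimes> s' \<otimes> e) \<oplus>\<^bsub>?K\<^esub> ?i (r \<otimes> s' \<oplus> s \<otimes> r') \<otimes>\<^bsub>?K\<^esub> c"
      using carr e by simp
    finally show "u \<otimes>\<^bsub>?K\<^esub> v \<in> S"
      using S_I[of "r \<otimes> r' \<oplus> s \<otimes> s' \<otimes> e" "r \<otimes> s' \<oplus> s \<otimes> r'"] carr e by simp
  qed
  interpret S: cring "?K\<lparr>carrier := S\<rparr>"
    using K.subcring_iff[of S] K.subcringI'[OF sub] subringE(1)[OF sub] by simp
  have c_S: "c \<in> S" using S_I[of \<zero> \<one>] c by simp
  interpret ext: square_cube_extension R "?K\<lparr>carrier := S\<rparr>" ?i c e f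
  proof
    show "?i \<in> ring_hom R (?K\<lparr>carrier := S\<rparr>)"
      by (rule ring_hom_memI) (simp_all add: R_S)
  qed (use c_S e f to_fraction_inj S_E in auto)
  have "integral_over ?K (?i ` carrier R) u" if "u \<in> S" for u
  proof -
    have "integral_over (?K\<lparr>carrier := S\<rparr>) (?i ` carrier R) u"
      using ext.is_integral_extension that by (simp add: integral_extension_def)
    then show ?thesis by (simp add: integral_over_def K.eval_consistent[OF sub])
  qed
  then have "S \<in> weakly_subintegral_subextensions R"
    unfolding weakly_subintegral_subextensions_def integral_closure_def
    using sub R_S ext.weakly_subintegral subringE(1)[OF sub] by auto
  then have "S \<subseteq> ?i ` carrier R"
    using assms(1) by (simp add: weakly_normal_def is_weak_normalization_def)
  then show ?thesis using c_S by blast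
qed

text \<open>If \<open>u\<close> is a root of a monic polynomial of degree \<open>N\<close>, its powers are combinations of
  \<open>1, u, \<dots>, u\<^sup>N\<^sup>-\<^sup>1\<close>, and \<open>x\<^sup>N\<close> is a denominator of each of these because \<open>x u \<in> A\<close>.\<close>

lemma (in cring) integral_bounded_denominator:
  assumes "subring A R" and x: "x \<in> A" and u: "u \<in> carrier R" and xu: "x \<otimes> u \<in> A"
    and "integral_over R A u"
  shows "\<exists>N::nat. \<forall>n::nat. x [^] N \<otimes> u [^] n \<in> A"
proof -
  note A = subringE[OF assms(1)]
  have xR: "x \<in> carrier R" using x A(1) by blast
  obtain cs where cs: "set cs \<subseteq> A" and root: "eval (\<one> # cs) u = \<zero>"
    using assms(5) by (auto simp: integral_over_def)
  let ?N = "length cs"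
  have csR: "set cs \<subseteq> carrier R" using cs A(1) by blast
  have pow: "y [^] n \<in> A" if "y \<in> A" for y and n :: nat
    using that A by (induction n) auto
  \<comment> \<open>In the induction below, \<open>u\<^sup>n\<close> is replaced by a polynomial in \<open>u\<close> of degree less than \<open>n\<close>,
    and the hypothesis is needed for all its monomials at once.\<close>
  have eval_mem: "x [^] ?N \<otimes> (u [^] k \<otimes> eval ds u) \<in> A"
    if "set ds \<subseteq> A" "\<And>m. m < k + length ds \<Longrightarrow> x [^] ?N \<otimes> u [^] m \<in> A" for ds k
    using that
  proof (induction ds)
    case Nil
    then show ?case using u xR A(2) by simp
  next
    case (Cons d ds)
    have d: "d \<in> A" "d \<in> carrier R" "set ds \<subseteq> carrier R" using Cons.prems A(1) by auto
    have "x [^] ?N \<otimes> (u [^] k \<otimes> eval (d # ds) u) =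
        d \<otimes> (x [^] ?N \<otimes> u [^] (k + length ds)) \<oplus> x [^] ?N \<otimes> (u [^] k \<otimes> eval ds u)"
      using xR u d eval_in_carrier[OF d(3) u]
      by (simp add: r_distr nat_pow_mult[symmetric] m_ac)
    then show ?case using Cons d A(6,7) by simp
  qed
  have "x [^] ?N \<otimes> u [^] n \<in> A" for n :: nat
  proof (induction n rule: less_induct)
    case (less n)
    show ?case
    proof (cases "n < ?N")
      case True
      then have "x [^] ?N = x [^] (?N - n) \<otimes> x [^] n" using xR by (simp add: nat_pow_mult)
      then have "x [^] ?N \<otimes> u [^] n = x [^] (?N - n) \<otimes> (x \<otimes> u) [^] n"
        using xR u by (simp add: nat_pow_distrib m_assoc)
      then show ?thesis using pow x xu A(6) by simp
    next
      case False
      then have "u [^] n = u [^] (n - ?N) \<otimes> u [^] ?N" using u by (simp add: nat_pow_mult)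
      also have "u [^] ?N = \<ominus> eval cs u"
        using root u eval_in_carrier[OF csR u] by (intro minus_equality[symmetric]) simp_all
      finally have "x [^] ?N \<otimes> u [^] n = \<ominus> (x [^] ?N \<otimes> (u [^] (n - ?N) \<otimes> eval cs u))"
        using xR u eval_in_carrier[OF csR u] by (simp add: r_minus)
      moreover have "x [^] ?N \<otimes> (u [^] (n - ?N) \<otimes> eval cs u) \<in> A"
        using False less by (intro eval_mem cs) auto
      ultimately show ?thesis using A(5) by simp
    qed
  qed
  then show ?thesis by blast
qed

text \<open>If all powers from \<open>c\<^sup>N\<^sup>+\<^sup>1\<close> on are in \<open>R\<close> and \<open>N \<ge> 1\<close>, then the square and the cube of \<open>c\<^sup>N\<close> are
  among them, so \<open>c\<^sup>N \<in> R\<close> and \<open>N\<close> can be lowered.\<close>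

lemma (in domain) weakly_normal_powers:
  assumes "weakly_normal R" and c: "c \<in> carrier (total_quotient_ring R)"
    and "\<And>n::nat. n \<ge> N \<Longrightarrow> c [^]\<^bsub>total_quotient_ring R\<^esub> n \<in> to_fraction R ` carrier R"
  shows "c \<in> to_fraction R ` carrier R"
  using assms(3)
proof (induction N)
  let ?K = "total_quotient_ring R"
  interpret K: field ?K by (rule total_quotient_ring_is_field)
  {
    case 0
    show ?case using 0[of 1] c by simp
  next
    case (Suc N)
    show ?case
    proof (cases "N = 0")
      case True
      then show ?thesis using Suc.prems[of 1] c by simp
    next
      case False
      have pow: "(c [^]\<^bsub>?K\<^esub> N) [^]\<^bsub>?K\<^esub> k \<in> to_fraction R ` carrier R" if "k \<ge> 2" for k :: nat
      proof -
        have "Suc N \<le> N * 2" using False by simp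
        also have "\<dots> \<le> N * k" using that by simp
        finally show ?thesis using Suc.prems[of "N * k"] c by (simp add: K.nat_pow_pow)
      qed
      have "c [^]\<^bsub>?K\<^esub> N \<in> to_fraction R ` carrier R"
        by (rule weakly_normal_square_cube[OF assms(1) K.nat_pow_closed[OF c] pow pow]) simp_all
      then have "c [^]\<^bsub>?K\<^esub> n \<in> to_fraction R ` carrier R" if "n \<ge> N" for n
        using that Suc.prems[of n] by (cases "n = N") simp_all
      then show ?thesis by (rule Suc.IH)
    qed
  }
qed

theorem (in domain) weakly_normal_imp_weakly_arf:
  assumes "weakly_normal R"
  shows "weakly_arf R"
  unfolding weakly_arf_def nonzerodivisors_eq
proof (intro ballI impI, elim conjE)
  let ?K = "total_quotient_ring R" and ?i = "to_fraction R"
  let ?A = "?i ` carrier R"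
  interpret K: field ?K by (rule total_quotient_ring_is_field)
  interpret i: ring_hom_cring R ?K ?i
    by (intro ring_hom_cring.intro ring_hom_cring_axioms.intro is_cring K.is_cring to_fraction_hom)
  have sub: "subring ?A ?K"
    using i.ring.img_is_subring[OF carrier_is_subring] .
  note A = subringE[OF sub]
  fix x y z
  assume x: "x \<in> carrier R - {\<zero>}" and y: "y \<in> carrier R" and z: "z \<in> carrier R"
    and int: "fraction R y x \<in> integral_closure R" "fraction R z x \<in> integral_closure R"
  define a b c where "a = fraction R y x" and "b = fraction R z x" and "c = fraction R (y \<otimes> z) x"
  note defs = a_def b_def c_def
  have carr: "?i x \<in> carrier ?K" "a \<in> carrier ?K" "b \<in> carrier ?K" "c \<in> carrier ?K"
    using x y z by (simp_all add: defs fraction_closed)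
  have xA: "?i x \<in> ?A" using x by simp
  have "?i x \<otimes>\<^bsub>?K\<^esub> a \<in> ?A" "?i x \<otimes>\<^bsub>?K\<^esub> b \<in> ?A"
    using x y z by (simp_all add: defs to_fraction_mult_fraction)
  then obtain M N :: nat
    where M: "\<And>n::nat. ?i x [^]\<^bsub>?K\<^esub> M \<otimes>\<^bsub>?K\<^esub> a [^]\<^bsub>?K\<^esub> n \<in> ?A"
      and N: "\<And>n::nat. ?i x [^]\<^bsub>?K\<^esub> N \<otimes>\<^bsub>?K\<^esub> b [^]\<^bsub>?K\<^esub> n \<in> ?A"
    using K.integral_bounded_denominator[OF sub xA carr(2)]
      K.integral_bounded_denominator[OF sub xA carr(3)] int
    unfolding integral_closure_def defs by blast
  have c_eq: "c = ?i x \<otimes>\<^bsub>?K\<^esub> (a \<otimes>\<^bsub>?K\<^esub> b)"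
    using x y z by (simp add: defs to_fraction_def fraction_mult fraction_eq_iff integral_iff m_ac)
  have pow: "?i x [^]\<^bsub>?K\<^esub> n \<in> ?A" for n :: nat
    using xA A(3,6) by (induction n) auto
  have "c \<in> ?A"
  proof (rule weakly_normal_powers[OF assms carr(4)])
    fix n assume "M + N \<le> n"
    then have "?i x [^]\<^bsub>?K\<^esub> n =
        ?i x [^]\<^bsub>?K\<^esub> (n - (M + N)) \<otimes>\<^bsub>?K\<^esub> (?i x [^]\<^bsub>?K\<^esub> M \<otimes>\<^bsub>?K\<^esub> ?i x [^]\<^bsub>?K\<^esub> N)"
      using carr by (simp add: K.nat_pow_mult)
    then have "c [^]\<^bsub>?K\<^esub> n = ?i x [^]\<^bsub>?K\<^esub> (n - (M + N)) \<otimes>\<^bsub>?K\<^esub>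
        ((?i x [^]\<^bsub>?K\<^esub> M \<otimes>\<^bsub>?K\<^esub> a [^]\<^bsub>?K\<^esub> n) \<otimes>\<^bsub>?K\<^esub> (?i x [^]\<^bsub>?K\<^esub> N \<otimes>\<^bsub>?K\<^esub> b [^]\<^bsub>?K\<^esub> n))"
      using carr by (simp add: c_eq K.nat_pow_distrib K.m_ac)
    then show "c [^]\<^bsub>?K\<^esub> n \<in> ?A"
      using A(6) pow M N by simp
  qed
  then show "fraction R (y \<otimes> z) x \<in> ?A" by (simp add: c_def)
qed

theorem corollary1p5:
  fixes R :: "('a, 'r) ring_scheme" and \<mm> :: "'a set" and d :: nat
  assumes "noetherian_domain R"
    and "local_ring R \<mm>"
    and "adic_complete R \<mm>"
    and "krull_dim R = enat d" and "d \<ge> 2"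
    and "Factorial_Ring.prime (ring_char R)"
    and "algebraically_closed (R Quot \<mm>)"
    and "generalized_cohen_macaulay TYPE('e) R \<mm>"
    and "weakly_normal R"
  shows "weakly_arf R"
  using domain.weakly_normal_imp_weakly_arf noetherian_domain.axioms(2) assms(1,9) by blast

end
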